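(* For a space $X$, the following are equivalent: (a) $X$ is normal and countably paracompact. (b) If $\Phi:X\to\mathscr{F}_{\mathbf c}(\mathbb{J}(\omega))$ is l.s.c., $\theta:X\to\mathscr{C}(\mathbb{J}(\omega))$ is u.s.c. and $\theta\leqslant\Phi$, then there exists a continuous mapping $\varphi:X\to\mathscr{C}_{\mathbf c}(\mathbb{J}(\omega))$ such that $\theta\leqslant\varphi\leqslant\Phi$.
   Context: All spaces are infinite Hausdorff topological spaces. For a set $Y$, $2^Y$ denotes the family of all nonempty subsets of $Y$. For a space $Y$: $\mathscr{F}(Y)$ and $\mathscr{C}(Y)$ are the families of all nonempty closed, respectively nonempty compact, subsets of $Y$; $\mathscr{F}_{\mathbf c}(Y)$ and $\mathscr{C}_{\mathbf c}(Y)$ are the families of their connected members. A mapping $\Phi:X\to 2^Y$ is l.s.c. if $\{x\in X:\Phi(x)\cap U\neq\varnothing\}$ is open for every open $U\subseteq Y$; u.s.c. if $\{x\in X:\Phi(x)\cap F\neq\varnothing\}$ is closed for every closed $F\subseteq Y$; continuous if it is both. For $\theta,\Phi:X\to 2^Y$, $\theta\leqslant\Phi$ means $\theta(x)\subseteq\Phi(x)$ for all $x\in X$. For a set $\mathscr{A}$, the metrizable hedgehog $\mathbb{J}(\mathscr{A})$ is the set $\{0\}\cup(0,1]\times\mathscr{A}$ with the metric $d(0,\langle s,\alpha\rangle)=s$, $d(\langle s,\alpha\rangle,\langle t,\beta\rangle)=|s-t|$ if $\alpha=\beta$, and $=s+t$ if $\alpha\neq\beta$. $\mathbb{J}(\omega)$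 is $\mathbb{J}(\mathscr{A})$ for a countably infinite set $\mathscr{A}$. *)

theory Defs
  imports "HOL-Analysis.Analysis"
begin

section \<open>Countable paracompactness\<close>

text \<open>Separation axioms are not part of this definition, nor of \<^const>\<open>normal_space\<close>;
  spaces are assumed to be Hausdorff separately.\<close>

definition countably_paracompact_space :: "'a topology \<Rightarrow> bool" where
  "countably_paracompact_space X \<longleftrightarrow>
     (\<forall>\<U>. countable \<U> \<and> (\<forall>U\<in>\<U>. openin X U) \<and> \<Union>\<U> = topspace X \<longrightarrow>
        (\<exists>\<V>. (\<forall>V\<in>\<V>. openin X V) \<and> \<Union>\<V> = topspace X \<and>
             (\<forall>V\<in>\<V>. \<exists>U\<in>\<U>. V \<subseteq> U) \<and> locally_finite_in X \<V>))"

section \<open>Hyperspaces and set-valued mappings\<close>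

definition closed_sets :: "'b topology \<Rightarrow> 'b set set" where
  "closed_sets Y = {S. S \<noteq> {} \<and> closedin Y S}"

definition compact_sets :: "'b topology \<Rightarrow> 'b set set" where
  "compact_sets Y = {S. S \<noteq> {} \<and> compactin Y S}"

definition connected_closed_sets :: "'b topology \<Rightarrow> 'b set set" where
  "connected_closed_sets Y = {S \<in> closed_sets Y. connectedin Y S}"

definition connected_compact_sets :: "'b topology \<Rightarrow> 'b set set" where
  "connected_compact_sets Y = {S \<in> compact_sets Y. connectedin Y S}"

text \<open>A set-valued mapping on \<open>X\<close> is a function whose values outside \<open>topspace X\<close> are
  irrelevant; the restriction on its values inside \<open>topspace X\<close> is always stated separately.\<close>

definition lower_semicontinuous :: "'a topology \<Rightarrow> 'b topology \<Rightarrow> ('a \<Rightarrow> 'b set) \<Rightarrow> bool" where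
  "lower_semicontinuous X Y \<Phi> \<longleftrightarrow>
     (\<forall>U. openin Y U \<longrightarrow> openin X {x \<in> topspace X. \<Phi> x \<inter> U \<noteq> {}})"

definition upper_semicontinuous :: "'a topology \<Rightarrow> 'b topology \<Rightarrow> ('a \<Rightarrow> 'b set) \<Rightarrow> bool" where
  "upper_semicontinuous X Y \<Phi> \<longleftrightarrow>
     (\<forall>F. closedin Y F \<longrightarrow> closedin X {x \<in> topspace X. \<Phi> x \<inter> F \<noteq> {}})"

definition set_valued_continuous :: "'a topology \<Rightarrow> 'b topology \<Rightarrow> ('a \<Rightarrow> 'b set) \<Rightarrow> bool" where
  "set_valued_continuous X Y \<Phi> \<longleftrightarrow> lower_semicontinuous X Y \<Phi> \<and> upper_semicontinuous X Y \<Phi>"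

section \<open>The metrizable hedgehog\<close>

text \<open>The hedgehog consists of \<open>Origin\<close> and of the points \<open>Spine s \<alpha>\<close> with \<open>0 < s \<le> 1\<close>. The
  absolute values of \<open>s\<close> and \<open>t\<close> below change nothing there; they are present because
  \<^locale>\<open>Metric_space\<close> demands nonnegativity on the whole type.\<close>

datatype 'i hedgehog_point = Origin | Spine real 'i

fun hedgehog_dist :: "'i hedgehog_point \<Rightarrow> 'i hedgehog_point \<Rightarrow> real" where
  "hedgehog_dist Origin Origin = 0"
| "hedgehog_dist Origin (Spine s \<alpha>) = \<bar>s\<bar>"
| "hedgehog_dist (Spine s \<alpha>) Origin = \<bar>s\<bar>"
| "hedgehog_dist (Spine s \<alpha>) (Spine t \<beta>) = (if \<alpha> = \<beta> then \<bar>s - t\<bar> else \<bar>s\<bar> + \<bar>t\<bar>)"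

definition hedgehog_points :: "'i set \<Rightarrow> 'i hedgehog_point set" where
  "hedgehog_points A = insert Origin {Spine s \<alpha> | s \<alpha>. 0 < s \<and> s \<le> 1 \<and> \<alpha> \<in> A}"

lemma Metric_space_hedgehog:
  fixes A :: "'i set"
  shows "Metric_space (hedgehog_points A) hedgehog_dist"
proof
  fix p q r :: "'i hedgehog_point"
  show "0 \<le> hedgehog_dist p q"
    by (cases p; cases q) auto
  show "hedgehog_dist p q = hedgehog_dist q p"
    by (cases p; cases q) auto
  show "hedgehog_dist p r \<le> hedgehog_dist p q + hedgehog_dist q r"
    by (cases p; cases q; cases r) auto
  show "hedgehog_dist p q = 0 \<longleftrightarrow> p = q" if "p \<in> hedgehog_points A" "q \<in> hedgehog_points A"
    using that by (cases p; cases q) (auto simp: hedgehog_points_def)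
qed

definition hedgehog :: "'i set \<Rightarrow> 'i hedgehog_point topology" where
  "hedgehog A = Metric_space.mtopology (hedgehog_points A) hedgehog_dist"

abbreviation hedgehog_omega :: "nat hedgehog_point topology" where
  "hedgehog_omega \<equiv> hedgehog UNIV"

end

theory Submission
  imports Defs
begin

text \<open>
  Sufficiency. In a normal space a continuous function can be inserted between an upper
  semicontinuous function and a lower semicontinuous one above it. Insert \<open>g m\<close> between the
  heights that \<open>\<theta>\<close> and \<open>\<Phi>\<close> reach on the \<open>m\<close>-th spine, and cut it down by majorants of the heights
  of \<open>\<theta>\<close> which tend to \<open>0\<close> locally uniformly; these exist by countable paracompactness. The
  resulting star-shaped sets contain \<open>\<theta>\<close>, are compact and connected, and vary continuously, but they
  always contain the origin. Where \<open>\<Phi>\<close> misses the origin, it lies on a single spine, and so does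
  \<open>\<theta>\<close>; hence the star is pushed along that spine by a distance \<open>w x\<close> inserted between
  the distances of \<open>\<Phi> x\<close> and of the connected hull of \<open>\<theta> x\<close> from the origin. Pushing fixes all points
  of \<open>\<theta> x\<close>, and it moves every point along an arc that stays in \<open>\<Phi> x\<close> if \<open>\<Phi> x\<close> contains the origin.

  Necessity. For decreasing closed sets \<open>F n\<close> with empty intersection, let \<open>\<theta> x\<close> consist of the origin
  and of the tips of the spines \<open>n\<close> with \<open>x \<in> F n\<close>. The set where a continuous compact-valued
  \<open>\<phi>\<close> reaches height more than \<open>1/2\<close> on the \<open>n\<close>-th spine is an open neighbourhood of \<open>F n\<close>, and these
  neighbourhoods are locally finite.
\<close>

section \<open>Insertion of continuous functions\<close>

text \<open>Average \<open>N\<close> Urysohn functions, the \<open>k\<close>-th of which separates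
  \<open>{g \<le> k / N}\<close> from \<open>{f \<ge> (k + 1) / N}\<close>; these sets are disjoint
  because \<open>f \<le> g\<close>. The average counts levels and so stays within
  \<open>1 / N\<close> of the interval from \<open>f x\<close> to \<open>g x\<close>.\<close>

lemma normal_space_approximate_insertion:
  fixes f g :: "'a \<Rightarrow> real"
  assumes X: "normal_space X"
    and usc: "\<And>c. openin X {x \<in> topspace X. f x < c}"
    and lsc: "\<And>c. openin X {x \<in> topspace X. g x > c}"
    and bounds: "\<And>x. x \<in> topspace X \<Longrightarrow> 0 \<le> f x \<and> f x \<le> g x \<and> g x \<le> 1"
    and "0 < e"
  obtains h where "continuous_map X euclideanreal h"
    "\<And>x. x \<in> topspace X \<Longrightarrow> f x - e \<le> h x \<and> h x \<le> g x + e"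
proof -
  obtain N :: nat where N: "0 < N" "1 / real N < e"
    using \<open>0 < e\<close> by (metis nat_approx_posE of_nat_Suc zero_less_Suc)
  have "\<forall>k. \<exists>u. continuous_map X (top_of_set {0..1}) u \<and>
      u ` {x \<in> topspace X. g x \<le> real k / real N} \<subseteq> {0} \<and> u ` {x \<in> topspace X. real (Suc k) / real N \<le> f x} \<subseteq> {1::real}"
    (is "\<forall>k. ?P k")
  proof
    fix k :: nat
    have "topspace X - {x \<in> topspace X. g x \<le> real k / real N} = {x \<in> topspace X. g x > real k / real N}"
      "topspace X - {x \<in> topspace X. real (Suc k) / real N \<le> f x} = {x \<in> topspace X. f x < real (Suc k) / real N}"
      by auto
    then have "closedin X {x \<in> topspace X. g x \<le> real k / real N}"
      "closedin X {x \<in> topspace X. real (Suc k) / real N \<le> f x}"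
      using usc lsc by (simp_all add: closedin_def)
    moreover have "disjnt {x \<in> topspace X. g x \<le> real k / real N} {x \<in> topspace X. real (Suc k) / real N \<le> f x}"
    proof -
      have *: "real k / real N < real (Suc k) / real N"
        by (rule divide_strict_right_mono) (use N in auto)
      have "\<not> real (Suc k) / real N \<le> f x" if "x \<in> topspace X" "g x \<le> real k / real N" for x
        using that * bounds[OF that(1)] by linarith
      then show ?thesis by (auto simp: disjnt_def)
    qed
    ultimately obtain u where "continuous_map X (top_of_set {0..1}) u"
      "u ` {x \<in> topspace X. g x \<le> real k / real N} \<subseteq> {0}" "u ` {x \<in> topspace X. real (Suc k) / real N \<le> f x} \<subseteq> {1::real}"
      by (rule Urysohn_lemma[OF X, where a = 0 and b = 1]) auto
    then show "?P k" by blast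
  qed
  from choice[OF this] obtain u where "\<forall>k. continuous_map X (top_of_set {0..1}) (u k) \<and>
      u k ` {x \<in> topspace X. g x \<le> real k / real N} \<subseteq> {0} \<and>
      u k ` {x \<in> topspace X. real (Suc k) / real N \<le> f x} \<subseteq> {1::real}" ..
  then have u: "continuous_map X (top_of_set {0..1}) (u k)"
    and u': "u k ` {x \<in> topspace X. g x \<le> real k / real N} \<subseteq> {0}"
      "u k ` {x \<in> topspace X. real (Suc k) / real N \<le> f x} \<subseteq> {1}" for k
    by blast+
  have u0: "u k x = 0" if "x \<in> topspace X" "g x \<le> real k / real N" for k x
    using u'(1)[of k] that by blast
  have u1: "u k x = 1" if "x \<in> topspace X" "real (Suc k) / real N \<le> f x" for k x
    using u'(2)[of k] that by blast
  have u01: "0 \<le> u k x \<and> u k x \<le> 1" if "x \<in> topspace X" for k x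
    using u[of k] that by (auto simp: continuous_map_in_subtopology)
  have uc: "continuous_map X euclideanreal (u k)" for k
    using u[of k] continuous_map_into_fulltopology by blast
  show thesis
  proof
    show "continuous_map X euclideanreal (\<lambda>x. (\<Sum>k<N. u k x) * (1 / N))"
      using uc by (intro continuous_map_real_mult_right continuous_map_sum) auto
    fix x assume x: "x \<in> topspace X"
    \<comment> \<open>The summands of index below \<open>j\<close> equal 1 and those of index at
      least \<open>i\<close> vanish, so the sum lies between \<open>j\<close> and
      \<open>i\<close>.\<close>
    define j i where "j = nat \<lfloor>N * f x\<rfloor>" and "i = nat \<lceil>N * g x\<rceil>"
    have f0: "0 \<le> N * f x" "N * f x \<le> N" "0 \<le> N * g x" "N * g x \<le> N"
      using bounds[OF x] N by (auto simp: mult_le_cancel_left1)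
    have j: "real j \<le> N * f x" "N * f x < j + 1" and i: "N * g x \<le> i" "i < N * g x + 1"
      using f0 unfolding j_def i_def by linarith+
    then have jN: "j \<le> N" and iN: "i \<le> N"
      using f0 by linarith+
    have uj: "u k x = 1" if "k < j" for k
    proof (rule u1[OF x])
      have "real k + 1 \<le> N * f x" using that j by linarith
      then show "real (Suc k) / real N \<le> f x" using N by (simp add: field_simps)
    qed
    have ui: "u k x = 0" if "i \<le> k" for k
    proof (rule u0[OF x])
      have "N * g x \<le> real k" using that i by linarith
      then show "g x \<le> real k / real N" using N by (simp add: field_simps)
    qed
    have "real j = (\<Sum>k<j. u k x)" using uj by simp
    also have "\<dots> \<le> (\<Sum>k<N. u k x)"
      using jN u01[OF x] by (intro sum_mono2) auto
    finally have "N * f x - 1 \<le> (\<Sum>k<N. u k x)" using j by simp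
    then have "f x - 1 / N \<le> (\<Sum>k<N. u k x) * (1 / N)"
      using mult_right_mono[of "N * f x - 1" "\<Sum>k<N. u k x" "1 / N"] N by (simp add: diff_divide_distrib)
    moreover have "(\<Sum>k<N. u k x) = (\<Sum>k<i. u k x)"
      using iN ui by (intro sum.mono_neutral_right) auto
    moreover have "(\<Sum>k<i. u k x) \<le> i"
      using u01[OF x] sum_bounded_above[of "{..<i}" "\<lambda>k. u k x" 1] by simp
    ultimately have "f x - 1 / N \<le> (\<Sum>k<N. u k x) * (1 / N)" "(\<Sum>k<N. u k x) \<le> N * g x + 1"
      using i by linarith+
    moreover from this(2) have "(\<Sum>k<N. u k x) * (1 / N) \<le> g x + 1 / N"
      using mult_right_mono[of "\<Sum>k<N. u k x" "N * g x + 1" "1 / N"] N by (simp add: add_divide_distrib)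
    ultimately show "f x - e \<le> (\<Sum>k<N. u k x) * (1 / N) \<and> (\<Sum>k<N. u k x) * (1 / N) \<le> g x + e"
      using N(2) by linarith
  qed
qed

text \<open>The Katetov--Tong theorem, obtained as the uniform limit of approximate insertions that are
  successively confined to the tube of width \<open>2 * (1/2)^n\<close> around the previous one.\<close>

theorem normal_space_insertion:
  fixes f g :: "'a \<Rightarrow> real"
  assumes X: "normal_space X"
    and usc: "\<And>c. openin X {x \<in> topspace X. f x < c}"
    and lsc: "\<And>c. openin X {x \<in> topspace X. g x > c}"
    and bounds: "\<And>x. x \<in> topspace X \<Longrightarrow> 0 \<le> f x \<and> f x \<le> g x \<and> g x \<le> 1"
  obtains h where "continuous_map X euclideanreal h"
    "\<And>x. x \<in> topspace X \<Longrightarrow> f x \<le> h x \<and> h x \<le> g x"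
proof -
  define P where "P n h \<longleftrightarrow> continuous_map X euclideanreal h \<and>
      (\<forall>x\<in>topspace X. f x - (1/2)^n \<le> h x \<and> h x \<le> g x + (1/2)^n)" for n :: nat and h
  have "\<exists>h. \<forall>n. P n (h n) \<and> (\<forall>x\<in>topspace X. \<bar>h (Suc n) x - h n x\<bar> \<le> 2 * (1/2)^n)"
  proof (intro dependent_nat_choice)
    \<comment> \<open>The initial error \<open>(1/2)^0 = 1\<close> is as large as the range of
      \<open>f\<close> and \<open>g\<close>, so the zero function qualifies.\<close>
    have "P 0 (\<lambda>_. 0)"
      unfolding P_def using bounds by force
    then show "\<exists>h. P 0 h" by blast
    fix h n assume h: "P n h"
    define e :: real where "e = (1/2)^n"
    have e: "e > 0" by (simp add: e_def)
    have hc: "continuous_map X euclideanreal h"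
      and he: "\<And>x. x \<in> topspace X \<Longrightarrow> f x - e \<le> h x \<and> h x \<le> g x + e"
      using h by (auto simp: P_def e_def)
    have hlt: "openin X {x \<in> topspace X. h x < c}" "openin X {x \<in> topspace X. h x > c}" for c
      using hc unfolding continuous_map_upper_lower_semicontinuous_lt by auto
    \<comment> \<open>The \<open>e\<close>-tube around \<open>h\<close> meets the interval from
      \<open>f x\<close> to \<open>g x\<close>, since \<open>h\<close> errs by at most
      \<open>e\<close>. The slack \<open>e/2\<close> halves the error, and \<open>k\<close> departs
      from \<open>h\<close> by at most \<open>3 * e / 2\<close>.\<close>
    obtain k where k: "continuous_map X euclideanreal k" "\<And>x. x \<in> topspace X \<Longrightarrow>
        max (f x) (h x - e) - e/2 \<le> k x \<and> k x \<le> min (g x) (h x + e) + e/2"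
    proof (rule normal_space_approximate_insertion[OF X, of "\<lambda>x. max (f x) (h x - e)" "\<lambda>x. min (g x) (h x + e)" "e/2"])
      fix c
      have "{x \<in> topspace X. max (f x) (h x - e) < c} = {x \<in> topspace X. f x < c} \<inter> {x \<in> topspace X. h x < c + e}"
        by auto
      then show "openin X {x \<in> topspace X. max (f x) (h x - e) < c}"
        using openin_Int[OF usc[of c] hlt(1)[of "c + e"]] by simp
      have "{x \<in> topspace X. min (g x) (h x + e) > c} = {x \<in> topspace X. g x > c} \<inter> {x \<in> topspace X. h x > c - e}"
        by auto
      then show "openin X {x \<in> topspace X. min (g x) (h x + e) > c}"
        using openin_Int[OF lsc[of c] hlt(2)[of "c - e"]] by simp
    next
      fix x assume "x \<in> topspace X"
      then show "0 \<le> max (f x) (h x - e) \<and> max (f x) (h x - e) \<le> min (g x) (h x + e) \<and> min (g x) (h x + e) \<le> 1"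
        using bounds[of x] he[of x] e by auto
    qed (use e in auto)
    have "P (Suc n) k"
      unfolding P_def
    proof (intro conjI ballI k(1))
      fix x assume "x \<in> topspace X"
      from k(2)[OF this] show "f x - (1/2) ^ Suc n \<le> k x" "k x \<le> g x + (1/2) ^ Suc n"
        by (auto simp: e_def)
    qed
    moreover have "\<bar>k x - h x\<bar> \<le> 2 * (1/2)^n" if "x \<in> topspace X" for x
      using k(2)[OF that] e unfolding e_def[symmetric] by linarith
    ultimately show "\<exists>k. P (Suc n) k \<and> (\<forall>x\<in>topspace X. \<bar>k x - h x\<bar> \<le> 2 * (1/2)^n)"
      by blast
  qed
  then obtain h where h: "\<And>n. P n (h n)"
    and hS: "\<And>n x. x \<in> topspace X \<Longrightarrow> \<bar>h (Suc n) x - h n x\<bar> \<le> 2 * (1/2)^n"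
    by blast
  \<comment> \<open>The bound is the exact partial sum of the geometric series of the steps
    \<open>2 * (1/2)^i\<close>, so the induction closes without loss.\<close>
  have diff: "\<bar>h (n + k) x - h n x\<bar> \<le> 4 * (1/2)^n - 4 * (1/2)^(n + k)" if "x \<in> topspace X" for n k x
  proof (induction k)
    case (Suc k)
    then show ?case using hS[OF that, of "n + k"] by simp
  qed simp
  have pow: "\<exists>N. \<forall>n\<ge>N. c * (1/2)^n < e" if "0 < e" for e c :: real
  proof -
    have "(\<lambda>n. c * (1/2::real)^n) \<longlonglongrightarrow> c * 0"
      by (intro tendsto_intros LIMSEQ_power_zero) auto
    then show ?thesis
      using order_tendstoD(2)[of _ 0 sequentially e] that by (simp add: eventually_sequentially)
  qed
  obtain k where k: "continuous_map X euclideanreal k"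
    and klim: "\<And>e. 0 < e \<Longrightarrow> \<forall>\<^sub>F n in sequentially. \<forall>x\<in>topspace X. dist (h n x) (k x) < e"
  proof (rule Met_TC.continuous_map_uniformly_Cauchy_limit)
    show "\<forall>\<^sub>F n in sequentially. continuous_map X (Met_TC.mtopology) (h n)"
      using h by (simp add: P_def)
    fix e :: real assume "0 < e"
    then obtain N where N: "4 * (1/2)^N < e / 2"
      using pow[of "e/2" 4] by auto
    have "dist (h m x) (h N x) < e / 2" if "N \<le> m" "x \<in> topspace X" for m x
    proof -
      have "\<bar>h m x - h N x\<bar> \<le> 4 * (1/2)^N - 4 * (1/2)^m"
        using diff[OF that(2), of N "m - N"] that(1) by simp
      moreover have "(0::real) \<le> (1/2)^m" by simp
      ultimately show ?thesis
        using N unfolding dist_real_def by linarith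
    qed
    then have "dist (h m x) (h n x) < e" if "N \<le> m" "N \<le> n" "x \<in> topspace X" for m n x
      using dist_triangle_half_l that by blast
    then show "\<exists>N. \<forall>m n x. N \<le> m \<longrightarrow> N \<le> n \<longrightarrow> x \<in> topspace X \<longrightarrow> dist (h m x) (h n x) < e"
      by blast
  qed auto
  have "f x \<le> k x + e \<and> k x \<le> g x + e" if x: "x \<in> topspace X" and "0 < e" for x e
  proof -
    obtain M where M: "\<forall>n\<ge>M. \<forall>x\<in>topspace X. dist (h n x) (k x) < e/2"
      using klim[of "e/2"] \<open>0 < e\<close> by (auto simp: eventually_sequentially)
    obtain N where N: "\<forall>n\<ge>N. 1 * (1/2)^n < e/2" using pow[of "e/2" 1] \<open>0 < e\<close> by auto
    have "dist (h (max M N) x) (k x) < e/2" "(1/2)^(max M N) < e/2"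
      using M N x by auto
    moreover have "f x - (1/2)^(max M N) \<le> h (max M N) x" "h (max M N) x \<le> g x + (1/2)^(max M N)"
      using h[of "max M N"] x unfolding P_def by blast+
    ultimately show ?thesis
      unfolding dist_real_def by linarith
  qed
  then have "f x \<le> k x \<and> k x \<le> g x" if "x \<in> topspace X" for x
    using that by (blast intro: field_le_epsilon)
  with k that show thesis by blast
qed

section \<open>The hedgehog\<close>

interpretation hedgehog: Metric_space "hedgehog_points A" hedgehog_dist for A :: "'i set"
  by (rule Metric_space_hedgehog)

lemma topspace_hedgehog [simp]: "topspace (hedgehog A) = hedgehog_points A"
  by (simp add: hedgehog_def hedgehog.topspace_mtopology)

text \<open>Collapsing nonpositive parameters to the origin makes \<open>{0..1}\<close> an isometric
  parametrization of a closed spine, including its end at the origin.\<close>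

definition spine_point :: "'i \<Rightarrow> real \<Rightarrow> 'i hedgehog_point" where
  "spine_point \<alpha> s = (if s \<le> 0 then Origin else Spine s \<alpha>)"

text \<open>For \<open>B = {m}\<close> this is the coordinate along the spine \<open>m\<close>, for
  \<open>B = UNIV\<close> the distance from the origin; a tail \<open>B = {n..}\<close> measures how
  far a set extends along the spines from \<open>n\<close> on.\<close>

fun height :: "'i set \<Rightarrow> 'i hedgehog_point \<Rightarrow> real" where
  "height B Origin = 0"
| "height B (Spine s \<alpha>) = (if \<alpha> \<in> B then s else 0)"

lemma spine_point_0 [simp]: "spine_point \<alpha> 0 = Origin"
  by (simp add: spine_point_def)

lemma Origin_in_hedgehog_points [simp]: "Origin \<in> hedgehog_points A"
  by (simp add: hedgehog_points_def)

lemma hedgehog_points_nonempty [simp]: "hedgehog_points A \<noteq> {}"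
  using Origin_in_hedgehog_points by blast

lemma Spine_in_hedgehog_points [simp]:
  "Spine s \<alpha> \<in> hedgehog_points A \<longleftrightarrow> 0 < s \<and> s \<le> 1 \<and> \<alpha> \<in> A"
  by (simp add: hedgehog_points_def)

lemma spine_point_in_hedgehog_points: "\<alpha> \<in> A \<Longrightarrow> s \<le> 1 \<Longrightarrow> spine_point \<alpha> s \<in> hedgehog_points A"
  by (simp add: spine_point_def)

lemma dist_spine_point:
  "0 \<le> s \<Longrightarrow> 0 \<le> t \<Longrightarrow> hedgehog_dist (spine_point \<alpha> s) (spine_point \<alpha> t) = \<bar>s - t\<bar>"
  by (auto simp: spine_point_def)

lemma height_bounds: "y \<in> hedgehog_points A \<Longrightarrow> 0 \<le> height B y \<and> height B y \<le> 1"
  by (cases y) auto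

lemma height_eq_dist: "y \<in> hedgehog_points A \<Longrightarrow> height UNIV y = hedgehog_dist Origin y"
  by (cases y) auto

lemma eq_spine_point_height:
  "y \<in> hedgehog_points A \<Longrightarrow> 0 < height {\<alpha>} y \<Longrightarrow> y = spine_point \<alpha> (height {\<alpha>} y)"
  by (cases y) (auto simp: spine_point_def split: if_splits)

lemma height_le_dist:
  "p \<in> hedgehog_points A \<Longrightarrow> q \<in> hedgehog_points A \<Longrightarrow> \<bar>height B p - height B q\<bar> \<le> hedgehog_dist p q"
  by (cases p; cases q) auto

lemma continuous_map_height: "continuous_map (hedgehog A) euclideanreal (height B)"
  unfolding hedgehog_def hedgehog.continuous_map_from_metric
proof (intro conjI ballI allI impI)
  fix p and U :: "real set"
  assume p: "p \<in> hedgehog_points A" and U: "openin euclidean U \<and> height B p \<in> U"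
  then obtain e where e: "0 < e" "\<And>t. \<bar>t - height B p\<bar> < e \<Longrightarrow> t \<in> U"
    unfolding open_openin[symmetric] open_dist dist_real_def by blast
  have "height B q \<in> U" if "q \<in> hedgehog_points A" "hedgehog_dist p q < e" for q
    using height_le_dist[OF p that(1), of B] that(2) by (intro e(2)) linarith
  then show "\<exists>r>0. \<forall>q. q \<in> hedgehog_points A \<and> hedgehog_dist p q < r \<longrightarrow> height B q \<in> U"
    using e(1) by blast
qed simp

lemma openin_height_less: "openin (hedgehog A) {y \<in> hedgehog_points A. height B y < c}"
  and openin_height_greater: "openin (hedgehog A) {y \<in> hedgehog_points A. height B y > c}"
  and closedin_height_le: "closedin (hedgehog A) {y \<in> hedgehog_points A. height B y \<le> c}"
  and closedin_height_ge: "closedin (hedgehog A) {y \<in> hedgehog_points A. height B y \<ge> c}"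
  using continuous_map_height[of A B] continuous_map_upper_lower_semicontinuous_lt[of "hedgehog A" "height B"]
    continuous_map_upper_lower_semicontinuous_le[of "hedgehog A" "height B"]
  by auto

lemma continuous_map_spine_point:
  assumes "\<alpha> \<in> A"
  shows "continuous_map (top_of_set {0..1}) (hedgehog A) (spine_point \<alpha>)"
  unfolding hedgehog_def hedgehog.continuous_map_to_metric
proof (intro ballI allI impI)
  fix s e :: real assume "s \<in> topspace (top_of_set {0..1})" "0 < e"
  then show "\<exists>U. openin (top_of_set {0..1}) U \<and> s \<in> U \<and>
      (\<forall>t\<in>U. spine_point \<alpha> t \<in> hedgehog.mball A (spine_point \<alpha> s) e)"
    using assms by (intro exI[of _ "{0..1} \<inter> ball s e"] conjI openin_open_Int)
      (auto simp: hedgehog.in_mball spine_point_in_hedgehog_points dist_spine_point dist_real_def)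
qed

lemma compactin_spine_segment:
  assumes "\<alpha> \<in> A" "r \<le> 1"
  shows "compactin (hedgehog A) (spine_point \<alpha> ` {0..r})"
  by (rule image_compactin[OF _ continuous_map_spine_point[OF assms(1)]])
    (use assms(2) in \<open>auto simp: compactin_subtopology\<close>)

lemma connectedin_spine_segment:
  assumes "\<alpha> \<in> A" "r \<le> 1"
  shows "connectedin (hedgehog A) (spine_point \<alpha> ` {0..r})"
  by (rule connectedin_continuous_map_image[OF continuous_map_spine_point[OF assms(1)]])
    (use assms(2) in \<open>auto simp: connectedin_subtopology\<close>)

text \<open>Each segment with \<open>G \<alpha> \<ge> 0\<close> starts at the origin, so for
  nonempty \<open>A\<close> and nonnegative \<open>G\<close> the union is star-shaped about
  it.\<close>

definition star :: "('i \<Rightarrow> real) \<Rightarrow> 'i set \<Rightarrow> 'i hedgehog_point set" where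
  "star G A = (\<Union>\<alpha>\<in>A. spine_point \<alpha> ` {0..G \<alpha>})"

lemma star_iff:
  assumes "y \<in> hedgehog_points A" "A \<noteq> {}" "\<And>\<alpha>. 0 \<le> G \<alpha>"
  shows "y \<in> star G A \<longleftrightarrow> (\<forall>\<alpha>\<in>A. height {\<alpha>} y \<le> G \<alpha>)"
proof (cases y)
  case Origin
  obtain \<alpha> where "\<alpha> \<in> A" using assms(2) by blast
  moreover have "spine_point \<alpha> 0 \<in> spine_point \<alpha> ` {0..G \<alpha>}"
    using assms(3) by (intro imageI) simp
  ultimately have "y \<in> star G A"
    using Origin by (auto simp: star_def)
  then show ?thesis using Origin assms(3) by simp
next
  case (Spine s \<alpha>)
  with assms show ?thesis
    by (auto simp: star_def image_iff spine_point_def split: if_splits)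
qed

lemma star_subset: "(\<And>\<alpha>. \<alpha> \<in> A \<Longrightarrow> G \<alpha> \<le> 1) \<Longrightarrow> star G A \<subseteq> hedgehog_points A"
  by (fastforce simp: star_def intro: spine_point_in_hedgehog_points)

lemma connectedin_star:
  assumes "\<And>\<alpha>. 0 \<le> G \<alpha>" "\<And>\<alpha>. G \<alpha> \<le> 1"
  shows "connectedin (hedgehog A) (star G A)"
  unfolding star_def
proof (rule connectedin_Union)
  show "\<Inter> ((\<lambda>\<alpha>. spine_point \<alpha> ` {0..G \<alpha>}) ` A) \<noteq> {}"
    using assms(1) by (intro ex_in_conv[THEN iffD1] exI[of _ Origin]) (auto simp: image_iff intro!: bexI[of _ 0])
qed (use assms in \<open>auto intro: connectedin_spine_segment\<close>)

lemma connectedin_hedgehog_points: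
  assumes "A \<noteq> {}"
  shows "connectedin (hedgehog A) (hedgehog_points A)"
proof -
  have "star (\<lambda>_. 1) A = hedgehog_points A"
    using star_subset[of A "\<lambda>_. 1"] star_iff[of _ A "\<lambda>_. 1"] assms height_bounds by fastforce
  then show ?thesis
    using connectedin_star[of "\<lambda>_. 1" A] by simp
qed

text \<open>A cover member around the origin contains a ball of some radius \<open>e\<close> and
  absorbs all segments shorter than \<open>e\<close>. What remains is a finite union of compact
  segments.\<close>

lemma compactin_star:
  assumes G: "\<And>\<alpha>. 0 \<le> G \<alpha>" "\<And>\<alpha>. G \<alpha> \<le> 1" and "A \<noteq> {}"
    and fin: "\<And>e. 0 < e \<Longrightarrow> finite {\<alpha> \<in> A. e \<le> G \<alpha>}"
  shows "compactin (hedgehog A) (star G A)"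
  unfolding compactin_def
proof (intro conjI allI impI)
  show sub: "star G A \<subseteq> topspace (hedgehog A)"
    using star_subset[of A G] G by simp
  fix \<U> assume U: "(\<forall>U\<in>\<U>. openin (hedgehog A) U) \<and> star G A \<subseteq> \<Union>\<U>"
  have "Origin \<in> star G A" using G \<open>A \<noteq> {}\<close> by (simp add: star_iff)
  then obtain U0 where U0: "U0 \<in> \<U>" "Origin \<in> U0" using U by blast
  then obtain e where e: "0 < e" "hedgehog.mball A Origin e \<subseteq> U0"
    using U unfolding hedgehog_def hedgehog.openin_mtopology by blast
  define K where "K = (\<Union>\<alpha>\<in>{\<alpha> \<in> A. e \<le> G \<alpha>}. spine_point \<alpha> ` {0..G \<alpha>})"
  have "compactin (hedgehog A) K"
    unfolding K_def by (rule compactin_Union) (use fin e G in \<open>auto intro: compactin_spine_segment\<close>)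
  moreover have "K \<subseteq> \<Union>\<U>" 
  proof -
    have "K \<subseteq> star G A" by (auto simp: star_def K_def)
    then show ?thesis using U by blast
  qed
  ultimately obtain \<F> where F: "finite \<F>" "\<F> \<subseteq> \<U>" "K \<subseteq> \<Union>\<F>"
    using compactinD[of "hedgehog A" K \<U>] U by blast
  have "star G A \<subseteq> \<Union>(insert U0 \<F>)"
  proof
    fix y assume "y \<in> star G A"
    then obtain \<alpha> s where y: "\<alpha> \<in> A" "0 \<le> s" "s \<le> G \<alpha>" "y = spine_point \<alpha> s" by (auto simp: star_def)
    show "y \<in> \<Union>(insert U0 \<F>)"
    proof (cases "e \<le> G \<alpha>")
      case True
      then have "y \<in> K" using y by (auto simp: K_def)
      then show ?thesis using F by blast
    next
      case False
      moreover have "s \<le> 1" using y(3) G(2)[of \<alpha>] by linarith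
      ultimately have "y \<in> hedgehog.mball A Origin e"
        using dist_spine_point[of 0 s \<alpha>] y by (simp add: hedgehog.in_mball spine_point_in_hedgehog_points)
      then show ?thesis using e by blast
    qed
  qed
  then show "\<exists>\<F>. finite \<F> \<and> \<F> \<subseteq> \<U> \<and> star G A \<subseteq> \<Union>\<F>"
    using F U0 by (intro exI[of _ "insert U0 \<F>"]) auto
qed

text \<open>Each point lies on at most one spine, so its tail heights are eventually 0. Hence the
  open sets \<open>?U N\<close> increase to the whole hedgehog, and one of them contains
  \<open>K\<close>.\<close>

lemma compactin_hedgehog_tail:
  fixes K :: "nat hedgehog_point set"
  assumes K: "compactin hedgehog_omega K" and "0 < e"
  obtains N where "\<And>y. y \<in> K \<Longrightarrow> height {N..} y < e"
proof -
  let ?U = "\<lambda>N::nat. {y \<in> hedgehog_points UNIV. height {N..} y < e}"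
  have sub: "K \<subseteq> hedgehog_points UNIV" using compactin_subset_topspace[OF K] by simp
  have anti: "height {M..} y \<le> height {N..} y" if "N \<le> M" "y \<in> hedgehog_points UNIV" for N M :: nat and y
    using that by (cases y) (auto dest: order_trans)
  have "y \<in> (\<Union>N. ?U N)" if "y \<in> hedgehog_points UNIV" for y
  proof (cases y)
    case Origin
    then show ?thesis using \<open>0 < e\<close> by auto
  next
    case (Spine s n)
    then have "y \<in> ?U (Suc n)" using \<open>0 < e\<close> that by simp
    then show ?thesis by blast
  qed
  then have "K \<subseteq> \<Union>(range ?U)" using sub by blast
  moreover have "openin hedgehog_omega U" if "U \<in> range ?U" for U
    using that openin_height_less by auto
  ultimately have "\<exists>\<F>. finite \<F> \<and> \<F> \<subseteq> range ?U \<and> K \<subseteq> \<Union>\<F>"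
    by (intro compactinD[OF K])
  then obtain \<F> where F: "finite \<F>" "\<F> \<subseteq> range ?U" "K \<subseteq> \<Union>\<F>"
    by blast
  obtain I where I: "finite I" "\<F> = ?U ` I"
    using finite_subset_image[OF F(1,2)] by blast
  then have IK: "K \<subseteq> (\<Union>N\<in>I. ?U N)" using F(3) by simp
  show thesis
  proof (rule that[of "Max (insert 0 I)"])
    fix y assume "y \<in> K"
    then obtain N where "N \<in> I" "y \<in> ?U N" using IK by blast
    moreover from this have "N \<le> Max (insert 0 I)" using I(1) by simp
    ultimately show "height {Max (insert 0 I)..} y < e"
      using anti[of N "Max (insert 0 I)" y] by auto
  qed
qed

lemma connected_hedgehog_height_mem:
  assumes C: "connectedin (hedgehog A) C" and "y \<in> C" "y' \<in> C" "height B y \<le> r" "r \<le> height B y'"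
  shows "r \<in> height B ` C"
proof -
  have "connected (height B ` C)"
    using connectedin_continuous_map_image[OF continuous_map_height C] by simp
  then show ?thesis
    using assms unfolding connected_iff_interval by blast
qed

text \<open>If the point were missing, so would be a ball around it, and the heights of
  \<open>C\<close> on the spine would avoid a whole interval around \<open>r\<close>. This
  contradicts connectedness, since \<open>C\<close> has heights on both sides. It is the tool for
  recognizing members of \<open>\<Phi> x\<close>.\<close>

lemma connected_closed_hedgehog_mem:
  assumes C: "connectedin (hedgehog A) C" "closedin (hedgehog A) C" "C \<noteq> {}"
    and "0 < r" "Inf (height {\<alpha>} ` C) \<le> r" "r \<le> Sup (height {\<alpha>} ` C)" "\<alpha> \<in> A"
  shows "spine_point \<alpha> r \<in> C"
proof (rule ccontr)
  assume notin: "spine_point \<alpha> r \<notin> C"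
  have sub: "C \<subseteq> hedgehog_points A" using closedin_subset[OF C(2)] by simp
  have "Sup (height {\<alpha>} ` C) \<le> 1"
    using C(3) sub height_bounds by (intro cSup_least) auto
  then have "spine_point \<alpha> r \<in> hedgehog_points A - C"
    using notin assms by (auto intro: spine_point_in_hedgehog_points)
  moreover have "openin (hedgehog A) (hedgehog_points A - C)"
    using C(2) by (simp add: closedin_def)
  ultimately obtain e where e: "0 < e" "hedgehog.mball A (spine_point \<alpha> r) e \<subseteq> hedgehog_points A - C"
    unfolding hedgehog_def hedgehog.openin_mtopology by blast
  \<comment> \<open>\<open>d < r\<close> keeps the heights in the gap positive, so that they
    determine points of the spine; \<open>d < e\<close> keeps these points inside the missing
    ball.\<close>
  define d where "d = min e r / 2"
  have d: "0 < d" "d < e" "d < r" using e(1) \<open>0 < r\<close> by (auto simp: d_def)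
  have gap: "t \<notin> height {\<alpha>} ` C" if "\<bar>t - r\<bar> \<le> d" for t
  proof
    assume "t \<in> height {\<alpha>} ` C"
    then obtain y where y: "y \<in> C" "height {\<alpha>} y = t" by auto
    have "0 < t" using that d by linarith
    have yA: "y \<in> hedgehog_points A" using sub y(1) by blast
    have "y = spine_point \<alpha> t"
      using eq_spine_point_height[OF yA, of \<alpha>] y(2) \<open>0 < t\<close> by simp
    then have "hedgehog_dist (spine_point \<alpha> r) y = \<bar>r - t\<bar>"
      using \<open>0 < t\<close> \<open>0 < r\<close> by (simp add: dist_spine_point)
    also have "\<dots> < e" using that d(2) by linarith
    finally have "y \<in> hedgehog.mball A (spine_point \<alpha> r) e"
      using \<open>spine_point \<alpha> r \<in> hedgehog_points A - C\<close> yA by (simp add: hedgehog.in_mball)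
    with e y show False by blast
  qed
  have bdd: "bdd_below (height {\<alpha>} ` C)" "bdd_above (height {\<alpha>} ` C)"
    by (rule bdd_belowI2[of _ 0] bdd_aboveI2[of _ _ 1]; use sub height_bounds in blast)+
  have "Inf (height {\<alpha>} ` C) < r + d" "r - d < Sup (height {\<alpha>} ` C)"
    using assms(5,6) d(1) by linarith+
  then obtain y y' where y: "y \<in> C" "height {\<alpha>} y < r + d" and y': "y' \<in> C" "r - d < height {\<alpha>} y'"
    using bdd C(3) by (auto simp: cInf_less_iff less_cSup_iff)
  have "\<not> \<bar>height {\<alpha>} y - r\<bar> \<le> d" "\<not> \<bar>height {\<alpha>} y' - r\<bar> \<le> d"
    using gap[of "height {\<alpha>} y"] gap[of "height {\<alpha>} y'"] y(1) y'(1) by auto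
  then have "height {\<alpha>} y \<le> r" "r \<le> height {\<alpha>} y'" using y y' by linarith+
  then have "r \<in> height {\<alpha>} ` C"
    using connected_hedgehog_height_mem[OF C(1) y(1) y'(1)] by simp
  with gap[of r] d show False by simp
qed

text \<open>A ball of radius \<open>e\<close> around the origin misses \<open>C\<close>, so the
  height on any one spine is either 0 or at least \<open>e\<close> on \<open>C\<close>. By
  connectedness only one alternative occurs; for the spine of a point \<open>y0\<close> of
  \<open>C\<close> it is the second.\<close>

lemma connected_closed_hedgehog_avoiding_Origin:
  assumes C: "connectedin (hedgehog A) C" "closedin (hedgehog A) C" "C \<noteq> {}" and "Origin \<notin> C"
  obtains \<alpha> e where "\<alpha> \<in> A" "0 < e" "\<And>y. y \<in> C \<Longrightarrow> e \<le> height {\<alpha>} y"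
proof -
  have sub: "C \<subseteq> hedgehog_points A" using closedin_subset[OF C(2)] by simp
  have "openin (hedgehog A) (hedgehog_points A - C)"
    using C(2) by (simp add: closedin_def)
  then obtain e where e: "0 < e" "hedgehog.mball A Origin e \<subseteq> hedgehog_points A - C"
    unfolding hedgehog_def hedgehog.openin_mtopology using \<open>Origin \<notin> C\<close> using Origin_in_hedgehog_points by blast
  have far: "e \<le> height UNIV y" if "y \<in> C" for y
  proof (rule ccontr)
    assume "\<not> e \<le> height UNIV y"
    then have "y \<in> hedgehog.mball A Origin e"
      using that sub height_eq_dist[of y A] by (auto simp: hedgehog.in_mball)
    with e that show False by blast
  qed
  obtain y0 where y0: "y0 \<in> C" using C by blast
  then obtain s \<alpha> where "y0 = Spine s \<alpha>" using \<open>Origin \<notin> C\<close> by (cases y0) auto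
  then have \<alpha>: "\<alpha> \<in> A" "e \<le> height {\<alpha>} y0" using far[OF y0] y0 sub by auto
  have near: "height {\<alpha>} y = 0 \<or> e \<le> height {\<alpha>} y" if "y \<in> C" for y
    using far[OF that] by (cases y) auto
  have "e \<le> height {\<alpha>} y" if "y \<in> C" for y
  proof (rule ccontr)
    assume "\<not> e \<le> height {\<alpha>} y"
    then have "height {\<alpha>} y \<le> e / 2" "e / 2 \<le> height {\<alpha>} y0"
      using near[OF that] \<alpha>(2) e(1) by linarith+
    then have "e / 2 \<in> height {\<alpha>} ` C"
      using connected_hedgehog_height_mem[OF C(1) that y0] by simp
    with near e(1) show False by force
  qed
  with \<alpha>(1) e(1) show thesis by (rule that)
qed

section \<open>Semicontinuous mappings\<close>

text \<open>The first half of the closeness condition gives lower semicontinuity through a ball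
  around a single point. The second half gives upper semicontinuity, where compactness keeps the
  value uniformly away from a disjoint closed set.\<close>

lemma (in Metric_space) set_valued_continuous_if_Hausdorff_continuous:
  assumes cpt: "\<And>x. x \<in> topspace X \<Longrightarrow> compactin mtopology (\<phi> x)"
    and near: "\<And>x e. x \<in> topspace X \<Longrightarrow> 0 < e \<Longrightarrow> \<exists>N. openin X N \<and> x \<in> N \<and>
      (\<forall>x'\<in>N. (\<forall>y\<in>\<phi> x. \<exists>z\<in>\<phi> x'. d y z < e) \<and> (\<forall>z\<in>\<phi> x'. \<exists>y\<in>\<phi> x. d y z < e))"
  shows "set_valued_continuous X mtopology \<phi>"
  unfolding set_valued_continuous_def
proof
  have sub: "\<phi> x \<subseteq> M" if "x \<in> topspace X" for x
    using compactin_subset_topspace[OF cpt[OF that]] by simp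
  show "lower_semicontinuous X mtopology \<phi>"
    unfolding lower_semicontinuous_def
  proof (intro allI impI)
    fix U assume U: "openin mtopology U"
    show "openin X {x \<in> topspace X. \<phi> x \<inter> U \<noteq> {}}"
    proof (subst openin_subopen, rule ballI)
      fix x assume "x \<in> {x \<in> topspace X. \<phi> x \<inter> U \<noteq> {}}"
      then obtain y where x: "x \<in> topspace X" and y: "y \<in> \<phi> x" "y \<in> U" by blast
      then obtain e where e: "0 < e" "mball y e \<subseteq> U"
        using U unfolding openin_mtopology by blast
      obtain N where N: "openin X N" "x \<in> N" "\<forall>x'\<in>N. \<exists>z\<in>\<phi> x'. d y z < e"
        using near[OF x e(1)] y(1) by blast
      have "N \<subseteq> {x \<in> topspace X. \<phi> x \<inter> U \<noteq> {}}"
      proof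
        fix x' assume "x' \<in> N"
        then have x': "x' \<in> topspace X" using openin_subset[OF N(1)] by blast
        obtain z where z: "z \<in> \<phi> x'" "d y z < e" using N(3) \<open>x' \<in> N\<close> by blast
        then have "z \<in> mball y e" using sub[OF x] sub[OF x'] y(1) by (simp add: subsetD)
        with e z x' show "x' \<in> {x \<in> topspace X. \<phi> x \<inter> U \<noteq> {}}" by blast
      qed
      with N show "\<exists>N. openin X N \<and> x \<in> N \<and> N \<subseteq> {x \<in> topspace X. \<phi> x \<inter> U \<noteq> {}}" by blast
    qed
  qed
  show "upper_semicontinuous X mtopology \<phi>"
    unfolding upper_semicontinuous_def
  proof (intro allI impI)
    fix F assume F: "closedin mtopology F"
    have eq: "topspace X - {x \<in> topspace X. \<phi> x \<inter> F \<noteq> {}} = {x \<in> topspace X. \<phi> x \<inter> F = {}}"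
      by blast
    have "openin X {x \<in> topspace X. \<phi> x \<inter> F = {}}"
    proof (subst openin_subopen, rule ballI)
      fix x assume "x \<in> {x \<in> topspace X. \<phi> x \<inter> F = {}}"
      then have x: "x \<in> topspace X" and disj: "\<phi> x \<inter> F = {}" by auto
      \<comment> \<open>A Lebesgue number of the one-element cover \<open>{M - F}\<close> is a
        radius at which no ball around a point of \<open>\<phi> x\<close> meets
        \<open>F\<close>.\<close>
      have "\<phi> x \<subseteq> \<Union>{M - F}" using sub[OF x] disj by auto
      moreover have "openin mtopology U" if "U \<in> {M - F}" for U
        using that F by (simp add: closedin_def)
      ultimately obtain e where e: "0 < e" "\<forall>y\<in>\<phi> x. \<exists>U\<in>{M - F}. mball y e \<subseteq> U"
        using lebesgue_number[OF cpt[OF x]] by meson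
      obtain N where N: "openin X N" "x \<in> N" "\<forall>x'\<in>N. \<forall>z\<in>\<phi> x'. \<exists>y\<in>\<phi> x. d y z < e"
        using near[OF x e(1)] by blast
      have "N \<subseteq> {x \<in> topspace X. \<phi> x \<inter> F = {}}"
      proof
        fix x' assume "x' \<in> N"
        then have x': "x' \<in> topspace X" using openin_subset[OF N(1)] by blast
        have "z \<notin> F" if z: "z \<in> \<phi> x'" for z
        proof -
          obtain y where y: "y \<in> \<phi> x" "d y z < e" using N(3) \<open>x' \<in> N\<close> z by blast
          then have "z \<in> mball y e" using sub[OF x] sub[OF x'] z by (simp add: subsetD)
          with e y show ?thesis by blast
        qed
        with x' show "x' \<in> {x \<in> topspace X. \<phi> x \<inter> F = {}}" by blast
      qed
      with N show "\<exists>N. openin X N \<and> x \<in> N \<and> N \<subseteq> {x \<in> topspace X. \<phi> x \<inter> F = {}}" by blast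
    qed
    with eq show "closedin X {x \<in> topspace X. \<phi> x \<inter> F \<noteq> {}}"
      unfolding closedin_def by auto
  qed
qed

context
  fixes X :: "'a topology" and Y :: "'b topology" and \<Phi> :: "'a \<Rightarrow> 'b set" and f :: "'b \<Rightarrow> real"
  assumes vals: "\<And>x. x \<in> topspace X \<Longrightarrow> \<Phi> x \<noteq> {} \<and> \<Phi> x \<subseteq> topspace Y"
    and cont: "continuous_map Y euclideanreal f"
    and bounds: "\<And>y. y \<in> topspace Y \<Longrightarrow> 0 \<le> f y \<and> f y \<le> 1"
begin

lemma bdd_image_value:
  assumes "x \<in> topspace X"
  shows "bdd_above (f ` \<Phi> x)" "bdd_below (f ` \<Phi> x)"
proof -
  have "0 \<le> f y \<and> f y \<le> 1" if "y \<in> \<Phi> x" for y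
    using vals[OF assms] bounds that by blast
  then show "bdd_above (f ` \<Phi> x)" "bdd_below (f ` \<Phi> x)"
    by (auto intro: bdd_aboveI2[of _ _ 1] bdd_belowI2[of _ 0])
qed

text \<open>The supremum exceeds \<open>c\<close> exactly when the value meets the open set
  \<open>{f > c}\<close>. This and its three companions turn semicontinuous mappings into
  semicontinuous real functions, to which insertion applies.\<close>

lemma openin_Sup_greater_if_lower_semicontinuous:
  assumes "lower_semicontinuous X Y \<Phi>"
  shows "openin X {x \<in> topspace X. Sup (f ` \<Phi> x) > c}"
proof -
  have "openin Y {y \<in> topspace Y. f y > c}"
    using cont continuous_map_upper_lower_semicontinuous_lt by blast
  moreover have "Sup (f ` \<Phi> x) > c \<longleftrightarrow> \<Phi> x \<inter> {y \<in> topspace Y. f y > c} \<noteq> {}" if "x \<in> topspace X" for x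
    using vals[OF that] bdd_image_value(1)[OF that] by (subst less_cSup_iff) auto
  then have "{x \<in> topspace X. Sup (f ` \<Phi> x) > c}
      = {x \<in> topspace X. \<Phi> x \<inter> {y \<in> topspace Y. f y > c} \<noteq> {}}"
    by blast
  ultimately show ?thesis
    using assms by (simp add: lower_semicontinuous_def)
qed

lemma openin_Inf_less_if_lower_semicontinuous:
  assumes "lower_semicontinuous X Y \<Phi>"
  shows "openin X {x \<in> topspace X. Inf (f ` \<Phi> x) < c}"
proof -
  have "openin Y {y \<in> topspace Y. f y < c}"
    using cont continuous_map_upper_lower_semicontinuous_lt by blast
  moreover have "Inf (f ` \<Phi> x) < c \<longleftrightarrow> \<Phi> x \<inter> {y \<in> topspace Y. f y < c} \<noteq> {}" if "x \<in> topspace X" for x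
    using vals[OF that] bdd_image_value(2)[OF that] by (subst cInf_less_iff) auto
  then have "{x \<in> topspace X. Inf (f ` \<Phi> x) < c}
      = {x \<in> topspace X. \<Phi> x \<inter> {y \<in> topspace Y. f y < c} \<noteq> {}}"
    by blast
  ultimately show ?thesis
    using assms by (simp add: lower_semicontinuous_def)
qed

text \<open>The values need not be compact, so missing \<open>{f \<ge> c}\<close> only gives a
  supremum of at most \<open>c\<close>. Strictness is recovered by a union over all
  \<open>t < c\<close>, each member of which is open by upper semicontinuity.\<close>

lemma openin_Sup_less_if_upper_semicontinuous:
  assumes "upper_semicontinuous X Y \<Phi>"
  shows "openin X {x \<in> topspace X. Sup (f ` \<Phi> x) < c}"
proof -
  have "openin X {x \<in> topspace X. \<Phi> x \<inter> {y \<in> topspace Y. t \<le> f y} = {}}" for t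
  proof -
    have "closedin Y {y \<in> topspace Y. t \<le> f y}"
      using cont continuous_map_upper_lower_semicontinuous_le by blast
    then have "closedin X {x \<in> topspace X. \<Phi> x \<inter> {y \<in> topspace Y. t \<le> f y} \<noteq> {}}"
      using assms by (simp add: upper_semicontinuous_def)
    moreover have "{x \<in> topspace X. \<Phi> x \<inter> {y \<in> topspace Y. t \<le> f y} = {}}
        = topspace X - {x \<in> topspace X. \<Phi> x \<inter> {y \<in> topspace Y. t \<le> f y} \<noteq> {}}"
      by blast
    ultimately show ?thesis by (simp add: openin_diff)
  qed
  then have "openin X (\<Union>t\<in>{..<c}. {x \<in> topspace X. \<Phi> x \<inter> {y \<in> topspace Y. t \<le> f y} = {}})"
    by blast
  moreover have "Sup (f ` \<Phi> x) < c \<longleftrightarrow> (\<exists>t<c. \<Phi> x \<inter> {y \<in> topspace Y. t \<le> f y} = {})"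
    if x: "x \<in> topspace X" for x
  proof
    assume "Sup (f ` \<Phi> x) < c"
    then obtain t where t: "Sup (f ` \<Phi> x) < t" "t < c" using dense by blast
    have "f y < t" if "y \<in> \<Phi> x" for y
      using cSup_upper[OF imageI[OF that] bdd_image_value(1)[OF x]] t(1) by linarith
    then show "\<exists>t<c. \<Phi> x \<inter> {y \<in> topspace Y. t \<le> f y} = {}"
      using t(2) by (force intro!: exI[of _ t])
  next
    assume "\<exists>t<c. \<Phi> x \<inter> {y \<in> topspace Y. t \<le> f y} = {}"
    then obtain t where t: "t < c" "\<Phi> x \<inter> {y \<in> topspace Y. t \<le> f y} = {}" by blast
    have "f y \<le> t" if "y \<in> \<Phi> x" for y
      using t(2) that vals[OF x] by force
    then have "Sup (f ` \<Phi> x) \<le> t"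
      using vals[OF x] by (intro cSup_least) auto
    with t(1) show "Sup (f ` \<Phi> x) < c" by linarith
  qed
  then have "(\<Union>t\<in>{..<c}. {x \<in> topspace X. \<Phi> x \<inter> {y \<in> topspace Y. t \<le> f y} = {}})
      = {x \<in> topspace X. Sup (f ` \<Phi> x) < c}"
    by auto
  ultimately show ?thesis by simp
qed

lemma openin_Inf_greater_if_upper_semicontinuous:
  assumes "upper_semicontinuous X Y \<Phi>"
  shows "openin X {x \<in> topspace X. Inf (f ` \<Phi> x) > c}"
proof -
  have "openin X {x \<in> topspace X. \<Phi> x \<inter> {y \<in> topspace Y. f y \<le> t} = {}}" for t
  proof -
    have "closedin Y {y \<in> topspace Y. f y \<le> t}"
      using cont continuous_map_upper_lower_semicontinuous_le by blast
    then have "closedin X {x \<in> topspace X. \<Phi> x \<inter> {y \<in> topspace Y. f y \<le> t} \<noteq> {}}"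
      using assms by (simp add: upper_semicontinuous_def)
    moreover have "{x \<in> topspace X. \<Phi> x \<inter> {y \<in> topspace Y. f y \<le> t} = {}}
        = topspace X - {x \<in> topspace X. \<Phi> x \<inter> {y \<in> topspace Y. f y \<le> t} \<noteq> {}}"
      by blast
    ultimately show ?thesis by (simp add: openin_diff)
  qed
  then have "openin X (\<Union>t\<in>{c<..}. {x \<in> topspace X. \<Phi> x \<inter> {y \<in> topspace Y. f y \<le> t} = {}})"
    by blast
  moreover have "Inf (f ` \<Phi> x) > c \<longleftrightarrow> (\<exists>t>c. \<Phi> x \<inter> {y \<in> topspace Y. f y \<le> t} = {})"
    if x: "x \<in> topspace X" for x
  proof
    assume "Inf (f ` \<Phi> x) > c"
    then obtain t where t: "t < Inf (f ` \<Phi> x)" "c < t" using dense by blast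
    have "t < f y" if "y \<in> \<Phi> x" for y
      using cInf_lower[OF imageI[OF that] bdd_image_value(2)[OF x]] t(1) by linarith
    then show "\<exists>t>c. \<Phi> x \<inter> {y \<in> topspace Y. f y \<le> t} = {}"
      using t(2) by (force intro!: exI[of _ t])
  next
    assume "\<exists>t>c. \<Phi> x \<inter> {y \<in> topspace Y. f y \<le> t} = {}"
    then obtain t where t: "c < t" "\<Phi> x \<inter> {y \<in> topspace Y. f y \<le> t} = {}" by blast
    have "t \<le> f y" if "y \<in> \<Phi> x" for y
      using t(2) that vals[OF x] by force
    then have "t \<le> Inf (f ` \<Phi> x)"
      using vals[OF x] by (intro cInf_greatest) auto
    with t(1) show "c < Inf (f ` \<Phi> x)" by linarith
  qed
  then have "(\<Union>t\<in>{c<..}. {x \<in> topspace X. \<Phi> x \<inter> {y \<in> topspace Y. f y \<le> t} = {}})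
      = {x \<in> topspace X. Inf (f ` \<Phi> x) > c}"
    by auto
  ultimately show ?thesis by simp
qed

end

section \<open>Necessity\<close>

text \<open>Condition (b) as a predicate, so that each implication can be stated on its own.\<close>

definition hedgehog_insertion_property :: "'a topology \<Rightarrow> bool" where
  "hedgehog_insertion_property X \<longleftrightarrow>
    (\<forall>\<Phi> \<theta>.
        \<Phi> \<in> topspace X \<rightarrow> connected_closed_sets hedgehog_omega \<and>
        lower_semicontinuous X hedgehog_omega \<Phi> \<and>
        \<theta> \<in> topspace X \<rightarrow> compact_sets hedgehog_omega \<and>
        upper_semicontinuous X hedgehog_omega \<theta> \<and>
        (\<forall>x\<in>topspace X. \<theta> x \<subseteq> \<Phi> x) \<longrightarrow>
        (\<exists>\<phi>. \<phi> \<in> topspace X \<rightarrow> connected_compact_sets hedgehog_omega \<and>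
             set_valued_continuous X hedgehog_omega \<phi> \<and>
             (\<forall>x\<in>topspace X. \<theta> x \<subseteq> \<phi> x \<and> \<phi> x \<subseteq> \<Phi> x)))"

text \<open>The common core of both necessity claims: normality uses only the sets of index 0,
  countable paracompactness takes \<open>S = {}\<close>. The mapping \<open>\<theta>\<close> records
  membership in \<open>F n\<close> by the tip of the spine \<open>n\<close>, and
  \<open>\<Phi>\<close> shrinks to the origin on \<open>S\<close>.\<close>

lemma antimono_closed_sequence_swelling:
  fixes F :: "nat \<Rightarrow> 'a set"
  assumes X: "hedgehog_insertion_property X"
    and F: "\<And>n. closedin X (F n)" "antimono F" "(\<Inter>n. F n) = {}"
    and S: "closedin X S" "S \<inter> F 0 = {}"
  obtains V W :: "nat \<Rightarrow> 'a set" where "\<And>n. openin X (V n)" "\<And>n. closedin X (W n)" "\<And>n. F n \<subseteq> V n" "\<And>n. V n \<subseteq> W n"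
    "antimono W" "(\<Inter>n. W n) = {}" "S \<inter> W 0 = {}"
proof -
  define \<theta> where "\<theta> x = insert Origin (Spine 1 ` {n. x \<in> F n})" for x
  define \<Phi> where "\<Phi> x = (if x \<in> S then {Origin} else hedgehog_points (UNIV :: nat set))" for x
  \<comment> \<open>Every \<open>F n\<close> lies in \<open>F 0\<close> and so avoids
    \<open>S\<close>; hence \<open>\<theta> x\<close> is just the origin for \<open>x\<close> in
    \<open>S\<close>, as \<open>\<Phi>\<close> demands.\<close>
  have FS: "F n \<subseteq> topspace X - S" for n
    using closedin_subset[OF F(1)[of n]] antimonoD[OF F(2) le0, of n] S(2) by blast
  have "finite {n. x \<in> F n}" for x
  proof -
    obtain N where "x \<notin> F N" using F(3) by blast
    then have "{n. x \<in> F n} \<subseteq> {..<N}" using antimonoD[OF F(2), of N] by (fastforce simp: not_less[symmetric])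
    then show ?thesis using finite_subset by blast
  qed
  then have \<theta>: "\<theta> \<in> topspace X \<rightarrow> compact_sets hedgehog_omega"
    by (auto simp: \<theta>_def compact_sets_def intro!: finite_imp_compactin)
  have usc: "upper_semicontinuous X hedgehog_omega \<theta>"
    unfolding upper_semicontinuous_def
  proof (intro allI impI)
    fix K assume "closedin hedgehog_omega K"
    consider "Origin \<in> K" | "Origin \<notin> K" "\<forall>n. Spine 1 n \<notin> K" | n where "Origin \<notin> K" "Spine 1 n \<in> K"
      by blast
    then show "closedin X {x \<in> topspace X. \<theta> x \<inter> K \<noteq> {}}"
    proof cases
      case 1
      then have "{x \<in> topspace X. \<theta> x \<inter> K \<noteq> {}} = topspace X" by (auto simp: \<theta>_def)
      then show ?thesis by simp
    next
      case 2
      then have "{x \<in> topspace X. \<theta> x \<inter> K \<noteq> {}} = {}" by (auto simp: \<theta>_def)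
      then show ?thesis by (metis closedin_empty)
    next
      case (3 n)
      \<comment> \<open>Since \<open>F\<close> decreases, the least index whose tip lies in
        \<open>K\<close> decides whether \<open>\<theta> x\<close> meets \<open>K\<close>.\<close>
      define m where "m = (LEAST n. Spine 1 n \<in> K)"
      have m: "Spine 1 m \<in> K" "\<And>n. Spine 1 n \<in> K \<Longrightarrow> m \<le> n"
        unfolding m_def using 3(2) by (auto intro: LeastI Least_le)
      have "{x \<in> topspace X. \<theta> x \<inter> K \<noteq> {}} = F m"
      proof
        show "{x \<in> topspace X. \<theta> x \<inter> K \<noteq> {}} \<subseteq> F m"
          using 3(1) antimonoD[OF F(2) m(2)] by (auto simp: \<theta>_def)
        show "F m \<subseteq> {x \<in> topspace X. \<theta> x \<inter> K \<noteq> {}}"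
          using m(1) FS[of m] by (auto simp: \<theta>_def)
      qed
      then show ?thesis using F(1) by simp
    qed
  qed
  have \<Phi>: "\<Phi> \<in> topspace X \<rightarrow> connected_closed_sets hedgehog_omega"
  proof -
    have "y = Origin" if "y \<in> hedgehog_points UNIV" "height UNIV y \<le> 0" for y :: "nat hedgehog_point"
      using that by (cases y) auto
    then have "{y \<in> hedgehog_points UNIV. height UNIV y \<le> 0} = {Origin :: nat hedgehog_point}"
      by auto
    then have "closedin hedgehog_omega {Origin}"
      using closedin_height_le[of UNIV UNIV 0] by metis
    then have "{Origin} \<in> connected_closed_sets hedgehog_omega"
      by (simp add: connected_closed_sets_def closed_sets_def)
    moreover have "hedgehog_points UNIV \<in> connected_closed_sets hedgehog_omega"
      using connectedin_hedgehog_points[of UNIV] closedin_topspace[of hedgehog_omega]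
      by (simp add: connected_closed_sets_def closed_sets_def)
    ultimately show ?thesis by (simp add: \<Phi>_def)
  qed
  have lsc: "lower_semicontinuous X hedgehog_omega \<Phi>"
    unfolding lower_semicontinuous_def
  proof (intro allI impI)
    fix U assume "openin hedgehog_omega U"
    then have "U \<subseteq> hedgehog_points UNIV" using openin_subset by fastforce
    then have "{x \<in> topspace X. \<Phi> x \<inter> U \<noteq> {}} =
        (if Origin \<in> U then topspace X else if U = {} then {} else topspace X - S)"
      by (auto simp: \<Phi>_def split: if_splits)
    then show "openin X {x \<in> topspace X. \<Phi> x \<inter> U \<noteq> {}}"
      using S(1) by (simp add: closedin_def)
  qed
  have "\<theta> x \<subseteq> \<Phi> x" for x
    using FS by (auto simp: \<theta>_def \<Phi>_def)
  then obtain \<phi> where \<phi>: "\<phi> \<in> topspace X \<rightarrow> connected_compact_sets hedgehog_omega"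
    and lsc_\<phi>: "lower_semicontinuous X hedgehog_omega \<phi>" and usc_\<phi>: "upper_semicontinuous X hedgehog_omega \<phi>"
    and between: "\<And>x. x \<in> topspace X \<Longrightarrow> \<theta> x \<subseteq> \<phi> x" "\<And>x. x \<in> topspace X \<Longrightarrow> \<phi> x \<subseteq> \<Phi> x"
    using X[unfolded hedgehog_insertion_property_def, rule_format, of \<Phi> \<theta>] \<theta> usc \<Phi> lsc
    by (auto simp: set_valued_continuous_def)
  \<comment> \<open>The strict inequality on one spine makes \<open>V n\<close> open by lower
    semicontinuity. The weak one on a whole tail makes \<open>W n\<close> closed by upper
    semicontinuity and decreasing in \<open>n\<close>.\<close>
  define V where "V n = {x \<in> topspace X. \<phi> x \<inter> {y \<in> hedgehog_points UNIV. height {n} y > 1/2} \<noteq> {}}" for n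
  define W where "W n = {x \<in> topspace X. \<phi> x \<inter> {y \<in> hedgehog_points UNIV. height {n..} y \<ge> 1/2} \<noteq> {}}" for n
  show thesis
  proof
    show "openin X (V n)" for n
      unfolding V_def by (rule lsc_\<phi>[unfolded lower_semicontinuous_def, rule_format, OF openin_height_greater])
    show "closedin X (W n)" for n
      unfolding W_def by (rule usc_\<phi>[unfolded upper_semicontinuous_def, rule_format, OF closedin_height_ge])
    show "F n \<subseteq> V n" for n
    proof
      fix x assume "x \<in> F n"
      then have "x \<in> topspace X" "Spine 1 n \<in> \<theta> x" using FS[of n] by (auto simp: \<theta>_def)
      moreover from this have "Spine 1 n \<in> \<phi> x" using between(1) by blast
      moreover have "Spine 1 n \<in> {y \<in> hedgehog_points UNIV. height {n} y > 1/2}" by simp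
      ultimately show "x \<in> V n" unfolding V_def by blast
    qed
    have le: "height {n} y \<le> height {n..} y" "n \<le> m \<Longrightarrow> height {m..} y \<le> height {n..} y"
      if "y \<in> hedgehog_points UNIV" for n m and y :: "nat hedgehog_point"
      using that by (cases y; auto)+
    show "V n \<subseteq> W n" for n
    proof
      fix x assume "x \<in> V n"
      then obtain y where "x \<in> topspace X" "y \<in> \<phi> x" "y \<in> hedgehog_points UNIV" "height {n} y > 1/2"
        by (auto simp: V_def)
      moreover from this have "height {n..} y \<ge> 1/2" using le(1)[of y n] by linarith
      ultimately show "x \<in> W n" by (auto simp: W_def)
    qed
    show "antimono W"
    proof (rule antimonoI, rule subsetI)
      fix n m x assume "n \<le> m" "x \<in> W m"
      then obtain y where "x \<in> topspace X" "y \<in> \<phi> x" "y \<in> hedgehog_points UNIV" "height {m..} y \<ge> 1/2"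
        by (auto simp: W_def)
      moreover from this have "height {n..} y \<ge> 1/2" using le(2)[of y n m] \<open>n \<le> m\<close> by linarith
      ultimately show "x \<in> W n" by (auto simp: W_def)
    qed
    show "(\<Inter>n. W n) = {}"
    proof (rule equals0I)
      fix x assume x: "x \<in> (\<Inter>n. W n)"
      then have "x \<in> topspace X" by (auto simp: W_def)
      then have "compactin hedgehog_omega (\<phi> x)"
        using \<phi> by (auto simp: connected_compact_sets_def compact_sets_def)
      then obtain N where N: "\<And>y. y \<in> \<phi> x \<Longrightarrow> height {N..} y < 1/2"
        using compactin_hedgehog_tail[of "\<phi> x" "1/2"] by auto
      from x have "x \<in> W N" by blast
      then show False using N by (force simp: W_def)
    qed
    show "S \<inter> W 0 = {}"
      using between(2) by (fastforce simp: W_def \<Phi>_def)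
  qed
qed

text \<open>For the sequence \<open>T, {}, {}, ...\<close> the open set \<open>V 0\<close> contains
  \<open>T\<close> and lies in the closed set \<open>W 0\<close>, which misses
  \<open>S\<close>.\<close>

lemma normal_space_if_hedgehog_insertion_property:
  assumes "hedgehog_insertion_property X"
  shows "normal_space X"
  unfolding normal_space_def
proof (intro allI impI)
  fix S T assume ST: "closedin X S \<and> closedin X T \<and> disjnt S T"
  define F where "F n = (if n = 0 then T else {})" for n :: nat
  have "closedin X (F n)" for n using ST by (simp add: F_def)
  moreover have "antimono F" by (auto simp: F_def antimono_def)
  moreover have "F 1 = {}" by (simp add: F_def)
  then have "(\<Inter>n. F n) = {}" by blast
  moreover have "S \<inter> F 0 = {}" using ST by (auto simp: F_def disjnt_def)
  ultimately obtain V W where VW: "\<And>n. openin X (V n)" "\<And>n. closedin X (W n)" "\<And>n. F n \<subseteq> V n"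
    "\<And>n. V n \<subseteq> W n" "S \<inter> W 0 = {}"
    using antimono_closed_sequence_swelling[OF assms, of F S] ST by metis
  show "\<exists>U V. openin X U \<and> openin X V \<and> S \<subseteq> U \<and> T \<subseteq> V \<and> disjnt U V"
  proof (intro exI conjI)
    show "openin X (topspace X - W 0)" using VW(2) by blast
    show "S \<subseteq> topspace X - W 0" using VW(5) ST closedin_subset by blast
    show "T \<subseteq> V 0" using VW(3)[of 0] by (simp add: F_def)
    show "disjnt (topspace X - W 0) (V 0)" using VW(4)[of 0] by (auto simp: disjnt_def)
  qed (rule VW(1))
qed

text \<open>Let \<open>F n\<close> be what the first \<open>n\<close> cover members leave uncovered.
  The sets \<open>u n \<inter> V n\<close> refine the cover, and the complement of
  \<open>W N\<close> meets only those with \<open>n < N\<close>.\<close>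

lemma countably_paracompact_space_if_hedgehog_insertion_property:
  assumes "hedgehog_insertion_property X"
  shows "countably_paracompact_space X"
  unfolding countably_paracompact_space_def
proof (intro allI impI)
  fix \<U> assume U: "countable \<U> \<and> (\<forall>U\<in>\<U>. openin X U) \<and> \<Union>\<U> = topspace X"
  show "\<exists>\<V>. (\<forall>V\<in>\<V>. openin X V) \<and> \<Union>\<V> = topspace X \<and> (\<forall>V\<in>\<V>. \<exists>U\<in>\<U>. V \<subseteq> U) \<and> locally_finite_in X \<V>"
  proof (cases "\<U> = {}")
    case True
    then show ?thesis using U by (intro exI[of _ "{}"]) (auto simp: locally_finite_in_def)
  next
    case False
    define u where "u = from_nat_into \<U>"
    have u: "range u = \<U>" using False U by (simp add: u_def range_from_nat_into)
    have uo: "openin X (u n)" for n using u U by blast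
    define F where "F n = topspace X - (\<Union>i<n. u i)" for n
    have "closedin X (F n)" for n
      unfolding F_def using uo by (intro closedin_diff) auto
    moreover have "antimono F" by (force simp: F_def antimono_def)
    moreover have "(\<Inter>n. F n) = {}"
    proof (rule equals0I)
      fix x assume x: "x \<in> (\<Inter>n. F n)"
      then have "x \<in> topspace X" by (auto simp: F_def)
      then obtain n where "x \<in> u n" using U u by blast
      then have "x \<notin> F (Suc n)" by (auto simp: F_def)
      with x show False by blast
    qed
    ultimately obtain V W where VW: "\<And>n. openin X (V n)" "\<And>n. closedin X (W n)" "\<And>n. F n \<subseteq> V n"
      "\<And>n. V n \<subseteq> W n" "antimono W" "(\<Inter>n. W n) = {}"
      using antimono_closed_sequence_swelling[OF assms, of F "{}"] by (metis Int_empty_left closedin_empty)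
    let ?V = "range (\<lambda>n. u n \<inter> V n)"
    have cover: "\<Union>?V = topspace X"
    proof
      show "\<Union>?V \<subseteq> topspace X" using openin_subset[OF uo] by blast
      show "topspace X \<subseteq> \<Union>?V"
      proof
        fix x assume x: "x \<in> topspace X"
        then obtain n where n: "x \<in> u n" using U u by blast
        \<comment> \<open>The first cover member containing \<open>x\<close> has an index
          \<open>m\<close> with \<open>x\<close> still in \<open>F m\<close>, hence in
          \<open>V m\<close>.\<close>
        define m where "m = (LEAST n. x \<in> u n)"
        have "x \<in> u m" "\<And>i. i < m \<Longrightarrow> x \<notin> u i"
          unfolding m_def using n by (auto intro: LeastI dest: not_less_Least)
        then have "x \<in> F m" "x \<in> u m" using x by (auto simp: F_def)
        then show "x \<in> \<Union>?V" using VW(3)[of m] by blast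
      qed
    qed
    moreover have "locally_finite_in X ?V"
      unfolding locally_finite_in_def
    proof (intro conjI ballI)
      show "\<Union>?V \<subseteq> topspace X" using cover by simp
      fix x assume x: "x \<in> topspace X"
      then obtain N where N: "x \<notin> W N" using VW(6) by blast
      have "n < N" if "(u n \<inter> V n) \<inter> (topspace X - W N) \<noteq> {}" for n
      proof (rule ccontr)
        assume "\<not> n < N"
        then have "V n \<subseteq> W N" using VW(4)[of n] antimonoD[OF VW(5), of N n] by auto
        with that show False by blast
      qed
      then have "{A \<in> ?V. A \<inter> (topspace X - W N) \<noteq> {}} \<subseteq> (\<lambda>n. u n \<inter> V n) ` {..<N}" by blast
      then have "finite {A \<in> ?V. A \<inter> (topspace X - W N) \<noteq> {}}"
        by (rule finite_subset) simp
      moreover have "openin X (topspace X - W N)" using VW(2) by blast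
      ultimately show "\<exists>V. openin X V \<and> x \<in> V \<and> finite {U \<in> ?V. U \<inter> V \<noteq> {}}"
        using x N by blast
    qed
    moreover have "\<forall>V\<in>?V. openin X V" using uo VW(1) by auto
    moreover have "\<forall>V\<in>?V. \<exists>U\<in>\<U>. V \<subseteq> U" using u by blast
    ultimately show ?thesis by (intro exI[of _ ?V]) simp
  qed
qed

section \<open>Majorants vanishing at infinity\<close>

text \<open>Take a locally finite open refinement of the cover by the complements of the
  \<open>T n\<close>. This yields open sets \<open>D n\<close> around \<open>T n\<close> that leave
  a neighbourhood of each point after finitely many \<open>n\<close>; Urysohn functions that vanish
  off \<open>D n\<close> do the rest.\<close>

lemma locally_vanishing_Urysohn_functions:
  fixes T :: "nat \<Rightarrow> 'a set"
  assumes "normal_space X" "countably_paracompact_space X"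
    and T: "\<And>n. closedin X (T n)" "antimono T" "(\<Inter>n. T n) = {}"
  obtains e :: "nat \<Rightarrow> 'a \<Rightarrow> real" where "\<And>n. continuous_map X euclideanreal (e n)"
    "\<And>n x. x \<in> T n \<Longrightarrow> e n x = 1"
    "\<And>x. x \<in> topspace X \<Longrightarrow> \<exists>U N. openin X U \<and> x \<in> U \<and> (\<forall>n\<ge>N. \<forall>y\<in>U. e n y = 0)"
proof -
  let ?U = "range (\<lambda>n. topspace X - T n)"
  have "\<Union>?U = topspace X" using T(3) by blast
  moreover have "\<forall>U\<in>?U. openin X U" using T(1) by blast
  moreover have "countable ?U" by simp
  ultimately have "\<exists>\<V>. (\<forall>V\<in>\<V>. openin X V) \<and> \<Union>\<V> = topspace X \<and>
      (\<forall>V\<in>\<V>. \<exists>U\<in>?U. V \<subseteq> U) \<and> locally_finite_in X \<V>"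
    by (intro assms(2)[unfolded countably_paracompact_space_def, rule_format] conjI)
  then obtain \<V> where V: "\<forall>V\<in>\<V>. openin X V" "\<Union>\<V> = topspace X"
    "\<forall>V\<in>\<V>. \<exists>U\<in>?U. V \<subseteq> U" "locally_finite_in X \<V>"
    by (elim exE conjE)
  have "\<exists>n. V \<inter> T n = {}" if "V \<in> \<V>" for V using V(3) that by blast
  then obtain N where N: "\<And>V. V \<in> \<V> \<Longrightarrow> V \<inter> T (N V) = {}" by metis
  \<comment> \<open>A refinement member \<open>V\<close> misses \<open>T n\<close> as soon as
    \<open>N V \<le> n\<close>, so the members with \<open>n < N V\<close> already cover
    \<open>T n\<close>.\<close>
  define D where "D n = \<Union>{V \<in> \<V>. n < N V}" for n
  have "openin X (D n)" for n unfolding D_def using V(1) by blast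
  moreover have TD: "T n \<subseteq> D n" for n
  proof
    fix x assume x: "x \<in> T n"
    then have "x \<in> topspace X" using closedin_subset[OF T(1)[of n]] by blast
    then obtain V where "V \<in> \<V>" "x \<in> V" using V(2) by blast
    moreover from this have "n < N V"
      using N[of V] antimonoD[OF T(2), of "N V" n] x by (cases "n < N V") auto
    ultimately show "x \<in> D n" by (auto simp: D_def)
  qed
  moreover have "disjnt (topspace X - D n) (T n)" for n using TD[of n] by (auto simp: disjnt_def)
  ultimately have "\<forall>n. \<exists>e. continuous_map X euclideanreal e \<and> e ` (topspace X - D n) \<subseteq> {0::real} \<and> e ` T n \<subseteq> {1}"
    using Urysohn_lemma_alt[OF assms(1) _ T(1)] by (metis closedin_diff closedin_topspace)
  from choice[OF this] obtain e where "\<forall>n. continuous_map X euclideanreal (e n) \<and>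
      e n ` (topspace X - D n) \<subseteq> {0::real} \<and> e n ` T n \<subseteq> {1}" ..
  then have e: "continuous_map X euclideanreal (e n)"
    and e0: "e n ` (topspace X - D n) \<subseteq> {0}" and e1: "e n ` T n \<subseteq> {1}" for n
    by blast+
  show thesis
  proof
    show "continuous_map X euclideanreal (e n)" for n by (rule e)
    show "e n x = 1" if "x \<in> T n" for n x using e1[of n] that by blast
    fix x assume "x \<in> topspace X"
    then obtain U where U: "openin X U" "x \<in> U" "finite {V \<in> \<V>. V \<inter> U \<noteq> {}}"
      using V(4) unfolding locally_finite_in_def by blast
    define M where "M = Max (insert 0 (N ` {V \<in> \<V>. V \<inter> U \<noteq> {}}))"
    have "e n y = 0" if "M \<le> n" "y \<in> U" for n y
    proof -
      have "N V \<le> M" if "V \<in> \<V>" "y \<in> V" for V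
        unfolding M_def using U(3) that \<open>y \<in> U\<close> by (intro Max_ge) auto
      then have "y \<notin> D n" using \<open>M \<le> n\<close> by (fastforce simp: D_def)
      then show ?thesis using e0[of n] openin_subset[OF U(1)] \<open>y \<in> U\<close> by blast
    qed
    with U show "\<exists>U N. openin X U \<and> x \<in> U \<and> (\<forall>n\<ge>N. \<forall>y\<in>U. e n y = 0)" by blast
  qed
qed

lemma continuous_map_Min:
  fixes f :: "'i \<Rightarrow> 'a \<Rightarrow> real"
  assumes "finite I" "I \<noteq> {}" "\<And>i. i \<in> I \<Longrightarrow> continuous_map X euclideanreal (f i)"
  shows "continuous_map X euclideanreal (\<lambda>x. Min ((\<lambda>i. f i x) ` I))"
  using assms
proof (induction I rule: finite_ne_induct)
  case (insert i I)
  then have "continuous_map X euclideanreal (\<lambda>x. min (f i x) (Min ((\<lambda>i. f i x) ` I)))"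
    by (intro continuous_map_real_min) auto
  then show ?case using insert by simp
qed simp

text \<open>For each \<open>k\<close>, \<open>max (1 / Suc k) (e k n)\<close> majorizes
  \<open>b n\<close>: where \<open>b n\<close> reaches \<open>1 / Suc k\<close>, the function
  \<open>e k n\<close> equals 1. Locally this maximum is eventually \<open>1 / Suc k\<close>, and
  the minimum over \<open>k\<close> combines all these bounds.\<close>

lemma locally_vanishing_majorants:
  fixes b :: "nat \<Rightarrow> 'a \<Rightarrow> real"
  assumes X: "normal_space X" "countably_paracompact_space X"
    and usc: "\<And>n c. openin X {x \<in> topspace X. b n x < c}"
    and bounds: "\<And>n x. x \<in> topspace X \<Longrightarrow> b n x \<le> 1"
    and anti: "\<And>m n x. x \<in> topspace X \<Longrightarrow> m \<le> n \<Longrightarrow> b n x \<le> b m x"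
    and lim: "\<And>x e. x \<in> topspace X \<Longrightarrow> 0 < e \<Longrightarrow> \<exists>n. b n x < e"
  obtains \<beta> :: "nat \<Rightarrow> 'a \<Rightarrow> real" where "\<And>n. continuous_map X euclideanreal (\<beta> n)"
    "\<And>n x. x \<in> topspace X \<Longrightarrow> b n x \<le> \<beta> n x"
    "\<And>x e. x \<in> topspace X \<Longrightarrow> 0 < e \<Longrightarrow> \<exists>U N. openin X U \<and> x \<in> U \<and> (\<forall>n\<ge>N. \<forall>y\<in>U. \<beta> n y < e)"
proof -
  define T where "T k n = {x \<in> topspace X. 1 / real (Suc k) \<le> b n x}" for k n
  have "\<exists>e. (\<forall>n. continuous_map X euclideanreal (e n)) \<and> (\<forall>n. \<forall>x\<in>T k n. e n x = 1) \<and>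
      (\<forall>x\<in>topspace X. \<exists>U N. openin X U \<and> x \<in> U \<and> (\<forall>n\<ge>N. \<forall>y\<in>U. e n y = (0::real)))" for k
  proof -
    have "topspace X - T k n = {x \<in> topspace X. b n x < 1 / real (Suc k)}" for n
      by (auto simp: T_def)
    then have cl: "closedin X (T k n)" for n
      using usc by (simp add: closedin_def T_def)
    have anti: "antimono (T k)"
    proof (rule antimonoI, rule subsetI)
      fix m n x assume "m \<le> n" "x \<in> T k n"
      then show "x \<in> T k m" using anti[of x m n] by (auto simp: T_def)
    qed
    have empty: "(\<Inter>n. T k n) = {}"
    proof (rule equals0I)
      fix x assume x: "x \<in> (\<Inter>n. T k n)"
      then have "x \<in> topspace X" by (auto simp: T_def)
      then obtain n where "b n x < 1 / real (Suc k)" using lim[of x "1 / real (Suc k)"] by auto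
      then have "x \<notin> T k n" by (simp add: T_def)
      with x show False by blast
    qed
    show ?thesis
      by (rule locally_vanishing_Urysohn_functions[OF X cl anti empty]) blast
  qed
  then have "\<forall>k. \<exists>e. (\<forall>n. continuous_map X euclideanreal (e n)) \<and> (\<forall>n. \<forall>x\<in>T k n. e n x = 1) \<and>
      (\<forall>x\<in>topspace X. \<exists>U N. openin X U \<and> x \<in> U \<and> (\<forall>n\<ge>N. \<forall>y\<in>U. e n y = (0::real)))" ..
  from choice[OF this] obtain e where
    "\<forall>k. (\<forall>n. continuous_map X euclideanreal (e k n)) \<and> (\<forall>n. \<forall>x\<in>T k n. e k n x = 1) \<and>
      (\<forall>x\<in>topspace X. \<exists>U N. openin X U \<and> x \<in> U \<and> (\<forall>n\<ge>N. \<forall>y\<in>U. e k n y = (0::real)))" ..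
  then have e: "continuous_map X euclideanreal (e k n)"
    and e1: "x \<in> T k n \<Longrightarrow> e k n x = 1"
    and e0: "x \<in> topspace X \<Longrightarrow> \<exists>U N. openin X U \<and> x \<in> U \<and> (\<forall>n\<ge>N. \<forall>y\<in>U. e k n y = 0)" for k n x
    by blast+
  \<comment> \<open>Only the indices \<open>k \<le> n\<close> enter, so the minimum is finite and
    continuous; a given \<open>k\<close> is available from \<open>n = k\<close> on.\<close>
  define \<beta> where "\<beta> n x = Min ((\<lambda>k. max (1 / real (Suc k)) (e k n x)) ` {..n})" for n x
  show thesis
  proof
    show "continuous_map X euclideanreal (\<beta> n)" for n
      unfolding \<beta>_def by (intro continuous_map_Min continuous_map_real_max e) auto
    show "b n x \<le> \<beta> n x" if x: "x \<in> topspace X" for n x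
    proof -
      have "b n x \<le> max (1 / real (Suc k)) (e k n x)" for k
        using e1[of x k n] bounds[OF x, of n] x by (cases "x \<in> T k n") (auto simp: T_def)
      then show ?thesis by (simp add: \<beta>_def)
    qed
    fix x and d :: real assume x: "x \<in> topspace X" and "0 < d"
    then obtain k where k: "1 / real (Suc k) < d" using nat_approx_posE by metis
    obtain U N where U: "openin X U" "x \<in> U" "\<forall>n\<ge>N. \<forall>y\<in>U. e k n y = 0" using e0[OF x, of k] by blast
    have "\<beta> n y < d" if "max N k \<le> n" "y \<in> U" for n y
    proof -
      have "\<beta> n y \<le> max (1 / real (Suc k)) (e k n y)"
        unfolding \<beta>_def using that by (intro Min_le) auto
      also have "\<dots> < d" using U(3) that k by simp
      finally show ?thesis .
    qed
    with U show "\<exists>U N. openin X U \<and> x \<in> U \<and> (\<forall>n\<ge>N. \<forall>y\<in>U. \<beta> n y < d)" by blast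
  qed
qed

text \<open>From some index on both values lie in \<open>[0, e)\<close> near \<open>x\<close>, so
  they differ by less than \<open>e\<close>; continuity handles the finitely many indices
  before.\<close>

lemma locally_equicontinuous_if_locally_vanishing:
  fixes G :: "nat \<Rightarrow> 'a \<Rightarrow> real"
  assumes G: "\<And>n. continuous_map X euclideanreal (G n)" "\<And>n x. x \<in> topspace X \<Longrightarrow> 0 \<le> G n x"
    and van: "\<And>x e. x \<in> topspace X \<Longrightarrow> 0 < e \<Longrightarrow> \<exists>U N. openin X U \<and> x \<in> U \<and> (\<forall>n\<ge>N. \<forall>y\<in>U. G n y < e)"
    and x: "x \<in> topspace X" and "0 < e"
  shows "\<exists>U. openin X U \<and> x \<in> U \<and> (\<forall>y\<in>U. \<forall>n. \<bar>G n y - G n x\<bar> < e)"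
proof -
  obtain U N where U: "openin X U" "x \<in> U" "\<forall>n\<ge>N. \<forall>y\<in>U. G n y < e" using van[OF x \<open>0 < e\<close>] by blast
  define B where "B n = {y \<in> topspace X. G n y < G n x + e} \<inter> {y \<in> topspace X. G n y > G n x - e}" for n
  have B: "openin X (B n)" "x \<in> B n" for n
    using G(1)[of n] x \<open>0 < e\<close> unfolding continuous_map_upper_lower_semicontinuous_lt by (auto simp: B_def)
  \<comment> \<open>Inserting \<open>U\<close> keeps the intersected family nonempty when
    \<open>N = 0\<close>.\<close>
  have "openin X (U \<inter> \<Inter>(insert U (B ` {..<N})))"
    using U B by (intro openin_Int openin_Inter) auto
  moreover have "x \<in> U \<inter> \<Inter>(insert U (B ` {..<N}))" using U B by auto
  moreover have "\<bar>G n y - G n x\<bar> < e" if y: "y \<in> U \<inter> \<Inter>(insert U (B ` {..<N}))" for n y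
  proof (cases "n < N")
    case True
    then have "y \<in> B n" using y by blast
    then show ?thesis by (auto simp: B_def abs_less_iff)
  next
    case False
    then have "G n y < e" "G n x < e" using U y by auto
    moreover have "0 \<le> G n y" "0 \<le> G n x"
      using G(2) x y openin_subset[OF U(1)] by blast+
    ultimately show ?thesis by linarith
  qed
  ultimately show ?thesis by (intro exI conjI) auto
qed

section \<open>Sufficiency\<close>

text \<open>\<open>push w \<alpha>\<close> moves each point by the distance \<open>w\<close> towards the point at height \<open>w\<close> on the spine
  \<open>\<alpha>\<close>, stopping there; points of the spine \<open>\<alpha>\<close> above that height stay fixed.\<close>

fun push :: "real \<Rightarrow> 'i \<Rightarrow> 'i hedgehog_point \<Rightarrow> 'i hedgehog_point" where
  "push w \<alpha> Origin = spine_point \<alpha> w"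
| "push w \<alpha> (Spine s \<beta>) =
    (if \<beta> = \<alpha> then spine_point \<alpha> (max s w)
     else if s \<le> w then spine_point \<alpha> (w - s) else spine_point \<beta> (s - w))"

lemma push_spine_point:
  assumes "0 \<le> s" "0 \<le> w"
  shows "push w \<alpha> (spine_point \<alpha> s) = spine_point \<alpha> (max s w)"
    and "\<beta> \<noteq> \<alpha> \<Longrightarrow> push w \<alpha> (spine_point \<beta> s) =
      (if s \<le> w then spine_point \<alpha> (w - s) else spine_point \<beta> (s - w))"
  using assms by (auto simp: spine_point_def)

text \<open>Without displacement the target spine does not matter, so its index may be arbitrary
  wherever \<open>w\<close> vanishes.\<close>

lemma push_0: "y \<in> hedgehog_points A \<Longrightarrow> push 0 \<alpha> y = y"
  by (cases y) (auto simp: spine_point_def)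

lemma push_in_hedgehog_points:
  "y \<in> hedgehog_points A \<Longrightarrow> \<alpha> \<in> A \<Longrightarrow> 0 \<le> w \<Longrightarrow> w \<le> 1 \<Longrightarrow> push w \<alpha> y \<in> hedgehog_points A"
  by (cases y) (auto intro!: spine_point_in_hedgehog_points)

text \<open>Together with \<open>dist_push_push_le\<close> this gives the joint estimate in the
  point and in \<open>w\<close> behind the continuity of \<open>\<phi>\<close>.\<close>

lemma dist_push_le:
  assumes "y \<in> hedgehog_points A" "z \<in> hedgehog_points A" "0 \<le> w"
  shows "hedgehog_dist (push w \<alpha> y) (push w \<alpha> z) \<le> hedgehog_dist y z"
  using assms by (cases y; cases z) (auto simp: spine_point_def)

lemma dist_push_push_le:
  assumes "y \<in> hedgehog_points A" "0 \<le> w" "0 \<le> w'"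
  shows "hedgehog_dist (push w \<alpha> y) (push w' \<alpha> y) \<le> \<bar>w - w'\<bar>"
  using assms by (cases y) (auto simp: spine_point_def)

lemma continuous_map_push:
  assumes "\<alpha> \<in> A" "0 \<le> w" "w \<le> 1"
  shows "continuous_map (hedgehog A) (hedgehog A) (push w \<alpha>)"
  unfolding hedgehog_def hedgehog.metric_continuous_map[OF Metric_space_hedgehog]
proof (intro conjI ballI allI impI)
  show "push w \<alpha> ` hedgehog_points A \<subseteq> hedgehog_points A"
    using assms by (auto intro: push_in_hedgehog_points)
  fix y and e :: real assume y: "y \<in> hedgehog_points A" and "0 < e"
  have "hedgehog_dist (push w \<alpha> y) (push w \<alpha> z) < e" if "z \<in> hedgehog_points A" "hedgehog_dist y z < e" for z
    using dist_push_le[OF y that(1) assms(2), of \<alpha>] that(2) by linarith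
  with \<open>0 < e\<close> show "\<exists>d>0. \<forall>z. z \<in> hedgehog_points A \<and> hedgehog_dist y z < d \<longrightarrow>
      hedgehog_dist (push w \<alpha> y) (push w \<alpha> z) < e" by blast
qed

text \<open>Cut \<open>y\<close> down, on its own spine, to the length that \<open>G'\<close>
  allows.\<close>

lemma star_near:
  assumes "y \<in> star G A" "\<And>\<alpha>. \<bar>G \<alpha> - G' \<alpha>\<bar> < e" "\<And>\<alpha>. 0 \<le> G' \<alpha>"
  shows "\<exists>z\<in>star G' A. hedgehog_dist y z < e"
proof -
  obtain \<alpha> s where y: "\<alpha> \<in> A" "0 \<le> s" "s \<le> G \<alpha>" "y = spine_point \<alpha> s"
    using assms(1) by (auto simp: star_def)
  show ?thesis
  proof
    show "spine_point \<alpha> (min s (G' \<alpha>)) \<in> star G' A"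
      unfolding star_def using y assms(3)[of \<alpha>] by (intro UN_I[of \<alpha>] imageI) auto
    have "hedgehog_dist y (spine_point \<alpha> (min s (G' \<alpha>))) = \<bar>s - min s (G' \<alpha>)\<bar>"
      using y assms(3)[of \<alpha>] by (simp add: dist_spine_point)
    then show "hedgehog_dist y (spine_point \<alpha> (min s (G' \<alpha>))) < e"
      using y(3) assms(2)[of \<alpha>] by linarith
  qed
qed

lemma hedgehog_insertion:
  fixes X :: "'a topology"
  assumes X: "normal_space X" "countably_paracompact_space X"
    and \<Phi>: "\<Phi> \<in> topspace X \<rightarrow> connected_closed_sets hedgehog_omega"
    and lsc: "lower_semicontinuous X hedgehog_omega \<Phi>"
    and \<theta>: "\<theta> \<in> topspace X \<rightarrow> compact_sets hedgehog_omega"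
    and usc: "upper_semicontinuous X hedgehog_omega \<theta>"
    and \<theta>\<Phi>: "\<And>x. x \<in> topspace X \<Longrightarrow> \<theta> x \<subseteq> \<Phi> x"
  obtains \<phi> where "\<phi> \<in> topspace X \<rightarrow> connected_compact_sets hedgehog_omega"
    "set_valued_continuous X hedgehog_omega \<phi>"
    "\<And>x. x \<in> topspace X \<Longrightarrow> \<theta> x \<subseteq> \<phi> x \<and> \<phi> x \<subseteq> \<Phi> x"
proof -

  \<comment> \<open>Values of \<open>\<Phi>\<close> and \<open>\<theta>\<close> and the range of
    their heights\<close>
  let ?J = "hedgehog_points (UNIV :: nat set)"
  have \<Phi>conn: "connectedin hedgehog_omega (\<Phi> x)" and \<Phi>clo: "closedin hedgehog_omega (\<Phi> x)"
    and \<Phi>ne: "\<Phi> x \<noteq> {}" if "x \<in> topspace X" for x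
    using \<Phi> that by (auto simp: connected_closed_sets_def closed_sets_def)
  have \<theta>cpt: "compactin hedgehog_omega (\<theta> x)" and \<theta>ne: "\<theta> x \<noteq> {}" if "x \<in> topspace X" for x
    using \<theta> that by (auto simp: compact_sets_def)
  have \<Phi>sub: "\<Phi> x \<subseteq> ?J" if "x \<in> topspace X" for x
    using closedin_subset[OF \<Phi>clo[OF that]] by simp
  have \<theta>sub: "\<theta> x \<subseteq> ?J" if "x \<in> topspace X" for x
    using compactin_subset_topspace[OF \<theta>cpt[OF that]] by simp
  have \<Phi>vals: "\<Phi> x \<noteq> {} \<and> \<Phi> x \<subseteq> topspace hedgehog_omega"
    and \<theta>vals: "\<theta> x \<noteq> {} \<and> \<theta> x \<subseteq> topspace hedgehog_omega" if "x \<in> topspace X" for x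
    using \<Phi>ne \<Phi>sub \<theta>ne \<theta>sub that by auto
  have height01: "0 \<le> height B y \<and> height B y \<le> 1" if "y \<in> topspace hedgehog_omega" for B y
    using that height_bounds[of y UNIV B] by simp
  note height_cont = continuous_map_height[where A = "UNIV :: nat set"]
  note bdd\<Phi> = bdd_image_value[where X = X and \<Phi> = \<Phi>, OF \<Phi>vals height_cont height01]
  note bdd\<theta> = bdd_image_value[where X = X and \<Phi> = \<theta>, OF \<theta>vals height_cont height01]
  have le_Sup\<Phi>: "height B y \<le> Sup (height B ` \<Phi> x)" and Inf\<Phi>_le: "Inf (height B ` \<Phi> x) \<le> height B y"
    if "x \<in> topspace X" "y \<in> \<Phi> x" for B x y
    using that bdd\<Phi> by (auto intro: cSup_upper cInf_lower)
  have le_Sup\<theta>: "height B y \<le> Sup (height B ` \<theta> x)" and Inf\<theta>_le: "Inf (height B ` \<theta> x) \<le> height B y"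
    if "x \<in> topspace X" "y \<in> \<theta> x" for B x y
    using that bdd\<theta> by (auto intro: cSup_upper cInf_lower)
  have Sup_\<theta>\<Phi>: "0 \<le> Sup (height B ` \<theta> x)" "Sup (height B ` \<theta> x) \<le> Sup (height B ` \<Phi> x)"
    "Sup (height B ` \<Phi> x) \<le> 1" "0 \<le> Inf (height B ` \<Phi> x)" "Inf (height B ` \<theta> x) \<le> 1"
    "Inf (height B ` \<Phi> x) \<le> Inf (height B ` \<theta> x)" if x: "x \<in> topspace X" for B x
  proof -
    obtain y where y: "y \<in> \<theta> x" using \<theta>ne[OF x] by blast
    have y01: "0 \<le> height B y" "height B y \<le> 1" using y \<theta>sub[OF x] height_bounds by blast+
    show "0 \<le> Sup (height B ` \<theta> x)" "Inf (height B ` \<theta> x) \<le> 1"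
      using le_Sup\<theta>[OF x y, of B] Inf\<theta>_le[OF x y, of B] y01 by linarith+
    show "Sup (height B ` \<theta> x) \<le> Sup (height B ` \<Phi> x)"
      using \<theta>ne[OF x] \<theta>\<Phi>[OF x] le_Sup\<Phi>[OF x] by (intro cSup_least) auto
    show "Inf (height B ` \<Phi> x) \<le> Inf (height B ` \<theta> x)"
      using \<theta>ne[OF x] \<theta>\<Phi>[OF x] Inf\<Phi>_le[OF x] by (intro cInf_greatest) auto
    show "Sup (height B ` \<Phi> x) \<le> 1"
      using \<Phi>ne[OF x] \<Phi>sub[OF x] height_bounds by (intro cSup_least) auto
    show "0 \<le> Inf (height B ` \<Phi> x)"
      using \<Phi>ne[OF x] \<Phi>sub[OF x] height_bounds by (intro cInf_greatest) auto
  qed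

  \<comment> \<open>Continuous heights inserted on each spine\<close>
  have "\<exists>g. continuous_map X euclideanreal g \<and>
      (\<forall>x\<in>topspace X. Sup (height {m} ` \<theta> x) \<le> g x \<and> g x \<le> Sup (height {m} ` \<Phi> x))" for m
    by (rule normal_space_insertion[OF X(1),
        of "\<lambda>x. Sup (height {m} ` \<theta> x)" "\<lambda>x. Sup (height {m} ` \<Phi> x)"])
      (use openin_Sup_less_if_upper_semicontinuous[where X = X and \<Phi> = \<theta>, OF \<theta>vals height_cont height01 usc]
        openin_Sup_greater_if_lower_semicontinuous[where X = X and \<Phi> = \<Phi>, OF \<Phi>vals height_cont height01 lsc] Sup_\<theta>\<Phi> in blast)+
  then have "\<forall>m. \<exists>g. continuous_map X euclideanreal g \<and>
      (\<forall>x\<in>topspace X. Sup (height {m} ` \<theta> x) \<le> g x \<and> g x \<le> Sup (height {m} ` \<Phi> x))" ..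
  from choice[OF this] obtain g where "\<forall>m. continuous_map X euclideanreal (g m) \<and>
      (\<forall>x\<in>topspace X. Sup (height {m} ` \<theta> x) \<le> g m x \<and> g m x \<le> Sup (height {m} ` \<Phi> x))" ..
  then have g: "continuous_map X euclideanreal (g m)"
    and g_ge: "x \<in> topspace X \<Longrightarrow> Sup (height {m} ` \<theta> x) \<le> g m x"
    and g_le: "x \<in> topspace X \<Longrightarrow> g m x \<le> Sup (height {m} ` \<Phi> x)" for m x
    by blast+

  \<comment> \<open>Star lengths that vanish locally uniformly\<close>
  have tail_mono: "height B y \<le> height B' y" if "B \<subseteq> B'" "y \<in> ?J" for B B' y
    using that by (cases y) auto
  have tail_Sup_mono: "Sup (height B ` \<theta> x) \<le> Sup (height B' ` \<theta> x)"
    if x: "x \<in> topspace X" and "B \<subseteq> B'" for B B' x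
  proof (rule cSup_least)
    fix t assume "t \<in> height B ` \<theta> x"
    then obtain y where y: "y \<in> \<theta> x" "t = height B y" by auto
    have "y \<in> ?J" using y(1) \<theta>sub[OF x] by blast
    with y le_Sup\<theta>[OF x y(1), of B'] tail_mono[OF \<open>B \<subseteq> B'\<close>] show "t \<le> Sup (height B' ` \<theta> x)"
      by fastforce
  qed (use \<theta>ne[OF x] in auto)
  obtain \<beta> where \<beta>: "\<And>n. continuous_map X euclideanreal (\<beta> n)"
    and \<beta>_ge: "\<And>n x. x \<in> topspace X \<Longrightarrow> Sup (height {n..} ` \<theta> x) \<le> \<beta> n x"
    and \<beta>_van: "\<And>x e. x \<in> topspace X \<Longrightarrow> 0 < e \<Longrightarrow> \<exists>U N. openin X U \<and> x \<in> U \<and> (\<forall>n\<ge>N. \<forall>y\<in>U. \<beta> n y < e)"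
  proof (rule locally_vanishing_majorants[OF X, of "\<lambda>n x. Sup (height {n..} ` \<theta> x)"])
    show "openin X {x \<in> topspace X. Sup (height {n..} ` \<theta> x) < c}" for n c
      by (rule openin_Sup_less_if_upper_semicontinuous[where X = X and \<Phi> = \<theta>, OF \<theta>vals height_cont height01 usc])
    show "Sup (height {n..} ` \<theta> x) \<le> 1" if "x \<in> topspace X" for n x
      using Sup_\<theta>\<Phi>(2,3)[OF that, of "{n..}"] by linarith
    show "Sup (height {n..} ` \<theta> x) \<le> Sup (height {m..} ` \<theta> x)" if "x \<in> topspace X" "m \<le> n" for m n x
      using tail_Sup_mono[OF that(1)] that(2) by simp
    show "\<exists>n. Sup (height {n..} ` \<theta> x) < e" if x: "x \<in> topspace X" and "0 < e" for x e
    proof -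
      obtain N where N: "\<And>y. y \<in> \<theta> x \<Longrightarrow> height {N..} y < e / 2"
        using compactin_hedgehog_tail[OF \<theta>cpt[OF x], of "e / 2"] \<open>0 < e\<close> by auto
      have "Sup (height {N..} ` \<theta> x) \<le> e / 2"
        using \<theta>ne[OF x] less_imp_le[OF N] by (intro cSup_least) auto
      then show ?thesis using \<open>0 < e\<close> by (intro exI[of _ N]) linarith
    qed
  qed blast

  \<comment> \<open>Both terms dominate the height of \<open>\<theta>\<close> on the spine
    \<open>m\<close>. The first keeps the star below the heights of \<open>\<Phi>\<close>, the
    second makes its lengths vanish locally uniformly.\<close>
  define G where "G m x = min (g m x) (\<beta> m x)" for m x
  have G: "continuous_map X euclideanreal (G m)" for m
    unfolding G_def using g \<beta> by (rule continuous_map_real_min)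
  have G_ge: "height {m} y \<le> G m x" if "x \<in> topspace X" "y \<in> \<theta> x" for m x y
    using le_Sup\<theta>[OF that, of "{m}"] g_ge[OF that(1), of m] \<beta>_ge[OF that(1), of m]
      tail_Sup_mono[OF that(1), of "{m}" "{m..}"] by (simp add: G_def)
  have G_le: "G m x \<le> Sup (height {m} ` \<Phi> x)" if "x \<in> topspace X" for m x
    using g_le[OF that, of m] by (simp add: G_def)
  have G01: "0 \<le> G m x" "G m x \<le> 1" if x: "x \<in> topspace X" for m x
  proof -
    obtain y where y: "y \<in> \<theta> x" using \<theta>ne[OF x] by blast
    have "0 \<le> height {m} y" using y \<theta>sub[OF x] height_bounds by blast
    then show "0 \<le> G m x" using G_ge[OF x y, of m] by linarith
    show "G m x \<le> 1" using G_le[OF x, of m] Sup_\<theta>\<Phi>(3)[OF x, of "{m}"] by linarith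
  qed
  have G_van: "\<exists>U N. openin X U \<and> x \<in> U \<and> (\<forall>n\<ge>N. \<forall>y\<in>U. G n y < e)" if "x \<in> topspace X" "0 < e" for x e
  proof -
    obtain U N where "openin X U" "x \<in> U" "\<forall>n\<ge>N. \<forall>y\<in>U. \<beta> n y < e"
      using \<beta>_van[of x e] \<open>x \<in> topspace X\<close> \<open>0 < e\<close> by blast
    then show ?thesis by (intro exI[of _ U] exI[of _ N]) (auto simp: G_def intro: le_less_trans[OF min.cobounded2])
  qed

  \<comment> \<open>Open sets on which \<open>\<theta>\<close> stays on one spine off the
    origin\<close>
  define away where "away n = {x \<in> topspace X. \<forall>y\<in>\<theta> x. 0 < height {n} y}" for n
  have away_open: "openin X (away n)" for n
  proof -
    have "closedin X {x \<in> topspace X. \<theta> x \<inter> {y \<in> ?J. height {n} y \<le> 0} \<noteq> {}}"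
      by (rule usc[unfolded upper_semicontinuous_def, rule_format, OF closedin_height_le])
    moreover have "away n = topspace X - {x \<in> topspace X. \<theta> x \<inter> {y \<in> ?J. height {n} y \<le> 0} \<noteq> {}}"
      using \<theta>sub by (fastforce simp: away_def not_less[symmetric])
    ultimately show ?thesis by (simp add: openin_diff)
  qed
  have away_unique: "m = n" if "x \<in> away m" "x \<in> away n" for x m n
  proof -
    have "x \<in> topspace X" using that by (simp add: away_def)
    then obtain y where "y \<in> \<theta> x" using \<theta>ne by blast
    with that have "0 < height {m} y" "0 < height {n} y" by (auto simp: away_def)
    then show ?thesis by (cases y) (auto split: if_splits)
  qed
  \<comment> \<open>The set where \<open>\<Phi>\<close> misses the origin need not be open, but the
    open sets \<open>away n\<close> cover it: there \<open>\<Phi> x\<close> lies on one spine, and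
    with it \<open>\<theta> x\<close>.\<close>
  have in_away: "\<exists>n e. x \<in> away n \<and> 0 < e \<and> (\<forall>y\<in>\<Phi> x. e \<le> height {n} y)"
    if x: "x \<in> topspace X" and "Origin \<notin> \<Phi> x" for x
  proof -
    obtain n e where "0 < e" "\<And>y. y \<in> \<Phi> x \<Longrightarrow> e \<le> height {n} y"
      using connected_closed_hedgehog_avoiding_Origin[OF \<Phi>conn[OF x] \<Phi>clo[OF x] \<Phi>ne[OF x] \<open>Origin \<notin> \<Phi> x\<close>] by blast
    then show ?thesis using \<theta>\<Phi>[OF x] x by (intro exI[of _ n] exI[of _ e]) (force simp: away_def)
  qed

  \<comment> \<open>the distance of the connected hull of \<open>\<theta> x\<close> from the origin\<close>
  define low where "low x = (if x \<in> \<Union>(range away) then Inf (height UNIV ` \<theta> x) else 0)" for x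
  have Inf\<theta>0: "0 \<le> Inf (height UNIV ` \<theta> x)" if "x \<in> topspace X" for x
    using Sup_\<theta>\<Phi>(4,6)[OF that, of UNIV] by linarith
  \<comment> \<open>\<open>low\<close> is nonnegative and lower semicontinuous on the open union of
    the sets \<open>away n\<close>, and 0 elsewhere.\<close>
  have low_lsc: "openin X {x \<in> topspace X. low x > c}" for c
  proof (cases "c < 0")
    case True
    then have "{x \<in> topspace X. low x > c} = topspace X"
      using Inf\<theta>0 by (force simp: low_def)
    then show ?thesis by simp
  next
    case False
    then have "{x \<in> topspace X. low x > c} = \<Union>(range away) \<inter> {x \<in> topspace X. Inf (height UNIV ` \<theta> x) > c}"
      by (auto simp: low_def)
    moreover have "openin X {x \<in> topspace X. Inf (height UNIV ` \<theta> x) > c}"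
      by (rule openin_Inf_greater_if_upper_semicontinuous[where X = X and \<Phi> = \<theta>, OF \<theta>vals height_cont height01 usc])
    ultimately show ?thesis using away_open by (auto intro!: openin_Int openin_Union)
  qed
  \<comment> \<open>Off the sets \<open>away n\<close> the value \<open>\<Phi> x\<close> contains
    the origin, so its distance from the origin is 0.\<close>
  have low_ge: "Inf (height UNIV ` \<Phi> x) \<le> low x" if x: "x \<in> topspace X" for x
  proof (cases "x \<in> \<Union>(range away)")
    case True
    then show ?thesis using Sup_\<theta>\<Phi>(6)[OF x, of UNIV] by (simp add: low_def)
  next
    case False
    then have "Origin \<in> \<Phi> x" using in_away[OF x] by blast
    then show ?thesis using Inf\<Phi>_le[OF x, of Origin UNIV] False by (simp add: low_def)
  qed

  \<comment> \<open>The pushing distance\<close>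
  obtain w where w: "continuous_map X euclideanreal w"
    and w_between: "\<And>x. x \<in> topspace X \<Longrightarrow> Inf (height UNIV ` \<Phi> x) \<le> w x \<and> w x \<le> low x"
  proof (rule normal_space_insertion[OF X(1), of "\<lambda>x. Inf (height UNIV ` \<Phi> x)" low])
    show "openin X {x \<in> topspace X. Inf (height UNIV ` \<Phi> x) < c}" for c
      by (rule openin_Inf_less_if_lower_semicontinuous[where X = X and \<Phi> = \<Phi>, OF \<Phi>vals height_cont height01 lsc])
    show "0 \<le> Inf (height UNIV ` \<Phi> x) \<and> Inf (height UNIV ` \<Phi> x) \<le> low x \<and> low x \<le> 1"
      if x: "x \<in> topspace X" for x
      using Sup_\<theta>\<Phi>(4,5)[OF x, of UNIV] low_ge[OF x] by (simp add: low_def)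
  qed (use low_lsc in blast)+
  have w01: "0 \<le> w x" "w x \<le> 1" if x: "x \<in> topspace X" for x
    using w_between[OF x] Sup_\<theta>\<Phi>(4,5)[OF x, of UNIV] by (auto simp: low_def split: if_splits)
  have w_zero: "w x = 0" if "x \<in> topspace X" "\<And>n. x \<notin> away n" for x
  proof -
    have "low x = 0" using that(2) by (simp add: low_def)
    then show ?thesis using w_between[OF that(1)] w01(1)[OF that(1)] by simp
  qed
  have w_le: "w x \<le> height {n} y" if "x \<in> away n" "y \<in> \<theta> x" for x n y
  proof -
    have x: "x \<in> topspace X" and "0 < height {n} y" using that by (auto simp: away_def)
    then have "height UNIV y = height {n} y" by (cases y) (auto split: if_splits)
    moreover have "w x \<le> Inf (height UNIV ` \<theta> x)"
      using w_between[OF x] that(1) by (auto simp: low_def split: if_splits)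
    ultimately show ?thesis using Inf\<theta>_le[OF x that(2), of UNIV] by linarith
  qed

  \<comment> \<open>The pushed star\<close>
  define idx where "idx x = (SOME n. x \<in> away n)" for x
  \<comment> \<open>Off the sets \<open>away n\<close> the choice is arbitrary, but there
    \<open>w x = 0\<close> and pushing is the identity on \<open>?J\<close>.\<close>
  have idx: "idx x = n" if "x \<in> away n" for x n
    unfolding idx_def using that away_unique by (blast intro: some_equality)
  define \<psi> where "\<psi> x = star (\<lambda>m. G m x) UNIV" for x
  define \<phi> where "\<phi> x = push (w x) (idx x) ` \<psi> x" for x
  have \<psi>sub: "\<psi> x \<subseteq> ?J" if "x \<in> topspace X" for x
    unfolding \<psi>_def using G01(2)[OF that] by (rule star_subset)
  have cpt: "compactin hedgehog_omega (\<phi> x)" and conn: "connectedin hedgehog_omega (\<phi> x)"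
    if x: "x \<in> topspace X" for x
  proof -
    have "finite {m. e \<le> G m x}" if "0 < e" for e
    proof -
      obtain U N where "x \<in> U" "\<forall>n\<ge>N. \<forall>y\<in>U. G n y < e" using G_van[OF x \<open>0 < e\<close>] by blast
      then have "{m. e \<le> G m x} \<subseteq> {..<N}" by (force simp: not_less[symmetric])
      then show ?thesis using finite_subset by blast
    qed
    then have "compactin hedgehog_omega (\<psi> x)"
      unfolding \<psi>_def using G01[OF x] by (intro compactin_star) auto
    then show "compactin hedgehog_omega (\<phi> x)"
      unfolding \<phi>_def using continuous_map_push[OF UNIV_I w01[OF x]] by (rule image_compactin)
    have "connectedin hedgehog_omega (\<psi> x)"
      unfolding \<psi>_def using G01[OF x] by (intro connectedin_star)
    with continuous_map_push[OF UNIV_I w01[OF x]] show "connectedin hedgehog_omega (\<phi> x)"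
      unfolding \<phi>_def by (rule connectedin_continuous_map_image)
  qed

  \<comment> \<open>Continuity of the pushed star\<close>
  have "set_valued_continuous X hedgehog_omega \<phi>"
    unfolding hedgehog_def
  proof (rule hedgehog.set_valued_continuous_if_Hausdorff_continuous)
    show "compactin (hedgehog.mtopology UNIV) (\<phi> x)" if "x \<in> topspace X" for x
      using cpt[OF that] by (simp add: hedgehog_def)
    fix x and e :: real assume x: "x \<in> topspace X" and e: "0 < e"
    obtain U where U: "openin X U" "x \<in> U" "\<forall>x'\<in>U. \<forall>n. \<bar>G n x' - G n x\<bar> < e / 2"
      using locally_equicontinuous_if_locally_vanishing[OF G G01(1) G_van x half_gt_zero[OF e]] by blast
    define W where "W = {x' \<in> topspace X. w x' < w x + e / 2} \<inter> {x' \<in> topspace X. w x' > w x - e / 2}"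
    have W: "openin X W" "x \<in> W"
      using w x e unfolding continuous_map_upper_lower_semicontinuous_lt W_def by auto
    \<comment> \<open>On \<open>away n\<close> the index is constant. If \<open>x\<close> lies in no
      such set, then \<open>w x = 0\<close> and pushing by \<open>w x\<close> is the identity for
      every index.\<close>
    obtain V where V: "openin X V" "x \<in> V"
      and same: "\<And>x' y. x' \<in> V \<Longrightarrow> y \<in> ?J \<Longrightarrow> push (w x) (idx x') y = push (w x) (idx x) y"
    proof (cases "\<exists>n. x \<in> away n")
      case True
      then obtain n where n: "x \<in> away n" by blast
      have "push (w x) (idx x') y = push (w x) (idx x) y" if "x' \<in> away n" for x' y
        using idx[OF n] idx[OF that] by simp
      with away_open n show thesis by (rule that)
    next
      case False
      then have "w x = 0" using w_zero[OF x] by blast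
      then show thesis
        using x by (intro that[of "topspace X"]) (simp_all add: push_0)
    qed
    have close: "hedgehog_dist (push (w x) (idx x) y) (push (w x') (idx x') z) < e"
      if x': "x' \<in> U \<inter> W \<inter> V" and yz: "y \<in> ?J" "z \<in> ?J" "hedgehog_dist y z < e / 2" for x' y z
    proof -
      have x't: "x' \<in> topspace X" using x' by (simp add: W_def)
      \<comment> \<open>Passing through \<open>?q\<close> changes first the pushing distance and
        then the point, each at a cost below \<open>e / 2\<close>.\<close>
      let ?p = "push (w x) (idx x') y" and ?q = "push (w x') (idx x') y" and ?r = "push (w x') (idx x') z"
      have "?p \<in> ?J" "?q \<in> ?J" "?r \<in> ?J"
        using w01[OF x] w01[OF x't] yz by (auto intro!: push_in_hedgehog_points)
      then have "hedgehog_dist ?p ?r \<le> hedgehog_dist ?p ?q + hedgehog_dist ?q ?r"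
        by (rule hedgehog.triangle)
      moreover have "hedgehog_dist ?p ?q \<le> \<bar>w x - w x'\<bar>"
        using yz(1) w01(1)[OF x] w01(1)[OF x't] by (rule dist_push_push_le)
      moreover have "w x' < w x + e / 2" "w x' > w x - e / 2" using x' by (simp_all add: W_def)
      moreover have "hedgehog_dist ?q ?r \<le> hedgehog_dist y z"
        using yz(1,2) w01(1)[OF x't] by (rule dist_push_le)
      ultimately have "hedgehog_dist ?p ?r < e" using yz(3) by linarith
      moreover have "?p = push (w x) (idx x) y" using same x' yz(1) by blast
      ultimately show ?thesis by simp
    qed
    show "\<exists>N. openin X N \<and> x \<in> N \<and> (\<forall>x'\<in>N. (\<forall>y\<in>\<phi> x. \<exists>z\<in>\<phi> x'. hedgehog_dist y z < e) \<and>
        (\<forall>z\<in>\<phi> x'. \<exists>y\<in>\<phi> x. hedgehog_dist y z < e))"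
    proof (intro exI[of _ "U \<inter> W \<inter> V"] conjI ballI)
      show "openin X (U \<inter> W \<inter> V)" using U W V by blast
      show "x \<in> U \<inter> W \<inter> V" using U W V by blast
      fix x' assume x': "x' \<in> U \<inter> W \<inter> V"
      then have x't: "x' \<in> topspace X" by (simp add: W_def)
      have G': "\<bar>G m x - G m x'\<bar> < e / 2" for m
        using U(3) x' abs_minus_commute[of "G m x"] by auto
      fix p assume "p \<in> \<phi> x"
      then obtain y where y: "y \<in> \<psi> x" "p = push (w x) (idx x) y" by (auto simp: \<phi>_def)
      obtain z where z: "z \<in> \<psi> x'" "hedgehog_dist y z < e / 2"
        using star_near[OF y(1)[unfolded \<psi>_def] G' G01(1)[OF x't]] by (auto simp: \<psi>_def)
      have "y \<in> ?J" "z \<in> ?J" using y(1) z(1) \<psi>sub[OF x] \<psi>sub[OF x't] by blast+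
      from close[OF x' this z(2)] show "\<exists>q\<in>\<phi> x'. hedgehog_dist p q < e"
        using y(2) z(1) by (auto simp: \<phi>_def)
    next
      fix x' assume x': "x' \<in> U \<inter> W \<inter> V"
      then have x't: "x' \<in> topspace X" by (simp add: W_def)
      have G': "\<bar>G m x' - G m x\<bar> < e / 2" for m
        using U(3) x' by auto
      fix q assume "q \<in> \<phi> x'"
      then obtain z where z: "z \<in> \<psi> x'" "q = push (w x') (idx x') z" by (auto simp: \<phi>_def)
      obtain y where y: "y \<in> \<psi> x" "hedgehog_dist z y < e / 2"
        using star_near[OF z(1)[unfolded \<psi>_def] G' G01(1)[OF x]] by (auto simp: \<psi>_def)
      have "y \<in> ?J" "z \<in> ?J" using y(1) z(1) \<psi>sub[OF x] \<psi>sub[OF x't] by blast+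
      moreover have "hedgehog_dist y z < e / 2" using y(2) by (simp add: hedgehog.commute)
      ultimately show "\<exists>p\<in>\<phi> x. hedgehog_dist p q < e"
        using close[OF x'] y(1) z(2) by (auto simp: \<phi>_def)
    qed
  qed

  \<comment> \<open>Containment of \<open>\<theta>\<close> in the pushed star\<close>
  moreover have "\<theta> x \<subseteq> \<phi> x" if x: "x \<in> topspace X" for x
  proof
    fix y assume y: "y \<in> \<theta> x"
    then have yJ: "y \<in> ?J" using \<theta>sub[OF x] by blast
    then have "y \<in> \<psi> x"
      using star_iff[of y UNIV "\<lambda>m. G m x"] G01(1)[OF x] G_ge[OF x y] by (simp add: \<psi>_def)
    \<comment> \<open>Either \<open>y\<close> lies on the target spine at height at least
      \<open>w x\<close>, or \<open>w x = 0\<close>.\<close>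
    moreover have "push (w x) (idx x) y = y"
    proof (cases "\<exists>n. x \<in> away n")
      case True
      then obtain n where n: "x \<in> away n" by blast
      have "0 < height {n} y" "w x \<le> height {n} y"
        using n y w_le[OF n y] by (auto simp: away_def)
      then show ?thesis
        using idx[OF n] by (cases y) (auto simp: spine_point_def split: if_splits)
    next
      case False
      then show ?thesis using w_zero[OF x] push_0[OF yJ] by auto
    qed
    ultimately show "y \<in> \<phi> x" unfolding \<phi>_def by (metis imageI)
  qed

  \<comment> \<open>Containment of the pushed star in \<open>\<Phi>\<close>\<close>
  moreover have "\<phi> x \<subseteq> \<Phi> x" if x: "x \<in> topspace X" for x
  proof
    fix p assume "p \<in> \<phi> x"
    then obtain z where "z \<in> \<psi> x" and p: "p = push (w x) (idx x) z" by (auto simp: \<phi>_def)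
    then obtain m s where s: "0 \<le> s" "s \<le> G m x" and z: "z = spine_point m s"
      by (auto simp: \<psi>_def star_def)
    note mem = connected_closed_hedgehog_mem[OF \<Phi>conn[OF x] \<Phi>clo[OF x] \<Phi>ne[OF x] _ _ _ UNIV_I]
    have w_Sup: "w x \<le> Sup (height {n} ` \<Phi> x)" if n: "x \<in> away n" for n
    proof -
      obtain y where y: "y \<in> \<theta> x" using \<theta>ne[OF x] by blast
      then have "y \<in> \<Phi> x" using \<theta>\<Phi>[OF x] by blast
      then show ?thesis using w_le[OF n y] le_Sup\<Phi>[OF x, of y "{n}"] by linarith
    qed
    have s_Sup: "s \<le> Sup (height {m} ` \<Phi> x)" using s(2) G_le[OF x, of m] by linarith
    show "p \<in> \<Phi> x"
    proof (cases "Origin \<in> \<Phi> x")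
      case True
      \<comment> \<open>With the origin in \<open>\<Phi> x\<close> every height from 0 up to the
        supremum is available on each spine. It then suffices that pushing produces heights at most
        \<open>max s (w x)\<close> on \<open>n\<close> and at most \<open>s\<close> on another
        spine.\<close>
      have spine: "spine_point k r \<in> \<Phi> x" if "0 \<le> r" "r \<le> Sup (height {k} ` \<Phi> x)" for k r
      proof (cases "r = 0")
        case False
        then show ?thesis
          using mem[of r k] that Inf\<Phi>_le[OF x True, of "{k}"] by simp
      qed (use True in simp)
      show ?thesis
      proof (cases "\<exists>n. x \<in> away n")
        case True
        then obtain n where n: "x \<in> away n" by blast
        show ?thesis
        proof (cases "m = n")
          case True
          then have "p = spine_point n (max s (w x))"
            using p z idx[OF n] push_spine_point(1)[OF s(1) w01(1)[OF x]] by simp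
          then show ?thesis using spine[of "max s (w x)" n] s(1) s_Sup w_Sup[OF n] True by simp
        next
          case False
          then have "p = (if s \<le> w x then spine_point n (w x - s) else spine_point m (s - w x))"
            using p z idx[OF n] push_spine_point(2)[OF s(1) w01(1)[OF x] False] by simp
          then show ?thesis
            using spine[of "w x - s" n] spine[of "s - w x" m] s(1) s_Sup w_Sup[OF n] w01(1)[OF x] by auto
        qed
      next
        case False
        then have "w x = 0" using w_zero[OF x] by blast
        moreover have "z \<in> ?J" using \<open>z \<in> \<psi> x\<close> \<psi>sub[OF x] by blast
        ultimately have "p = spine_point m s" using p z push_0 by metis
        then show ?thesis using spine[of s m] s(1) s_Sup by simp
      qed
    next
      case False
      then obtain n e where n: "x \<in> away n" and e: "0 < e" "\<And>y. y \<in> \<Phi> x \<Longrightarrow> e \<le> height {n} y"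
        using in_away[OF x] by blast
      have same: "height UNIV y = height {n} y" and other: "k \<noteq> n \<Longrightarrow> height {k} y = 0" if "y \<in> \<Phi> x" for y k
        using e(2)[OF that] e(1) by (cases y; auto split: if_splits)+
      have "height UNIV ` \<Phi> x = height {n} ` \<Phi> x" using same by (rule image_cong[OF refl])
      then have w_ge: "Inf (height {n} ` \<Phi> x) \<le> w x" using w_between[OF x] by simp
      moreover have "e \<le> Inf (height {n} ` \<Phi> x)"
        using e(2) \<Phi>ne[OF x] by (intro cInf_greatest) auto
      ultimately have "0 < w x" using e(1) by linarith
      \<comment> \<open>Here \<open>\<Phi> x\<close> lies on the spine \<open>n\<close> alone, so on
        every other spine the star is reduced to the origin, which is pushed to height
        \<open>w x\<close>. The resulting heights lie between the infimum and the supremum over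
        \<open>\<Phi> x\<close>.\<close>
      have "p = spine_point n (if m = n then max s (w x) else w x)"
      proof (cases "m = n")
        case True
        then show ?thesis using p z idx[OF n] push_spine_point(1)[OF s(1) w01(1)[OF x]] by simp
      next
        case False
        have "Sup (height {m} ` \<Phi> x) \<le> 0"
          using other[OF _ False] \<Phi>ne[OF x] by (intro cSup_least) auto
        then have "s = 0" using s(1) s_Sup by linarith
        with False show ?thesis using p z idx[OF n] by simp
      qed
      moreover have "spine_point n (if m = n then max s (w x) else w x) \<in> \<Phi> x"
        using \<open>0 < w x\<close> w_ge s_Sup w_Sup[OF n] by (intro mem) auto
      ultimately show ?thesis by simp
    qed
  qed
  moreover have "\<phi> x \<noteq> {}" if "x \<in> topspace X" for x
    using \<open>\<And>x. x \<in> topspace X \<Longrightarrow> \<theta> x \<subseteq> \<phi> x\<close>[OF that] \<theta>ne[OF that] by blast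
  then have "\<phi> \<in> topspace X \<rightarrow> connected_compact_sets hedgehog_omega"
    using cpt conn by (auto simp: connected_compact_sets_def compact_sets_def)
  ultimately show thesis by (intro that[of \<phi>]) auto
qed

theorem corollary5p3:
  fixes X :: "'a topology"
  assumes "infinite (topspace X)" and "Hausdorff_space X"
  shows "(normal_space X \<and> countably_paracompact_space X) \<longleftrightarrow>
    (\<forall>\<Phi> \<theta>.
        \<Phi> \<in> topspace X \<rightarrow> connected_closed_sets hedgehog_omega \<and>
        lower_semicontinuous X hedgehog_omega \<Phi> \<and>
        \<theta> \<in> topspace X \<rightarrow> compact_sets hedgehog_omega \<and>
        upper_semicontinuous X hedgehog_omega \<theta> \<and>
        (\<forall>x\<in>topspace X. \<theta> x \<subseteq> \<Phi> x) \<longrightarrow>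
        (\<exists>\<phi>. \<phi> \<in> topspace X \<rightarrow> connected_compact_sets hedgehog_omega \<and>
             set_valued_continuous X hedgehog_omega \<phi> \<and>
             (\<forall>x\<in>topspace X. \<theta> x \<subseteq> \<phi> x \<and> \<phi> x \<subseteq> \<Phi> x)))"
  unfolding hedgehog_insertion_property_def[symmetric]
proof
  assume X: "normal_space X \<and> countably_paracompact_space X"
  show "hedgehog_insertion_property X"
    unfolding hedgehog_insertion_property_def
  proof (intro allI impI, elim conjE)
    fix \<Phi> \<theta>
    assume \<Phi>\<theta>: "\<Phi> \<in> topspace X \<rightarrow> connected_closed_sets hedgehog_omega"
      "lower_semicontinuous X hedgehog_omega \<Phi>"
      "\<theta> \<in> topspace X \<rightarrow> compact_sets hedgehog_omega"
      "upper_semicontinuous X hedgehog_omega \<theta>"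
      and le: "\<forall>x\<in>topspace X. \<theta> x \<subseteq> \<Phi> x"
    show "\<exists>\<phi>. \<phi> \<in> topspace X \<rightarrow> connected_compact_sets hedgehog_omega \<and>
             set_valued_continuous X hedgehog_omega \<phi> \<and>
             (\<forall>x\<in>topspace X. \<theta> x \<subseteq> \<phi> x \<and> \<phi> x \<subseteq> \<Phi> x)"
      by (rule hedgehog_insertion[OF X[THEN conjunct1] X[THEN conjunct2] \<Phi>\<theta> bspec[OF le]]) blast+
  qed
qed (simp add: normal_space_if_hedgehog_insertion_property
      countably_paracompact_space_if_hedgehog_insertion_property)

end
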